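(* Let $L$ (logical system) and $S$ (physical system) be finite-dimensional quantum systems, let $\mathcal{E}_{S\leftarrow L}$ be an isometric encoding channel, and let $\mathcal{N}_S(\cdot)=\sum_i K_{S,i}(\cdot)K_{S,i}^\dagger$ be a noise channel on $S$. Let $H_L$ and $H_S$ be non-trivial Hermitian operators (Hamiltonians) on $L$ and $S$, defining the $U(1)$ actions $U_{L,\theta}=e^{-iH_L\theta}$, $U_{S,\theta}=e^{-iH_S\theta}$, $\theta\in\mathbb{R}$, and assume the Hamiltonian-in-Kraus-span condition $H_S\in\mathrm{span}\{K_{S,i}^\dagger K_{S,j}\}_{i,j}$. Then $$\delta_{\mathrm{G}} \gtrsim \sqrt{\frac{\Delta H_L - 2\epsilon\,\mathfrak{J}}{\Delta H_S}},$$ where $\delta_{\mathrm{G}}$, $\epsilon$, $\mathfrak{J}$, $\Delta$ and $\gtrsim$ are as defined in the context.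
   Context: For a unitary $U$, $\mathcal{U}(\cdot):=U(\cdot)U^\dagger$. For states, fidelity $f(\rho,\sigma)=\mathrm{Tr}\sqrt{\rho^{1/2}\sigma\rho^{1/2}}$ and purified distance $P(\rho,\sigma)=\sqrt{1-f(\rho,\sigma)^2}$. For channels, $P(\Phi_1,\Phi_2)=\max_\rho P((\Phi_1\otimes\mathbb{1})(\rho),(\Phi_2\otimes\mathbb{1})(\rho))$, maximized over states on the input system together with a reference system. For a Hermitian operator $X$, $\Delta X$ denotes its largest eigenvalue minus its smallest eigenvalue. QEC inaccuracy: $\epsilon:=\min_{\mathcal{R}_{L\leftarrow S}}P(\mathcal{R}_{L\leftarrow S}\circ\mathcal{N}_S\circ\mathcal{E}_{S\leftarrow L},\mathbb{1}_L)$, minimized over recovery channels $\mathcal{R}_{L\leftarrow S}$. Global covariance violation: $\delta_{\mathrm{G}}:=\max_{\theta}P(\mathcal{U}_{S,\theta}\circ\mathcal{E}_{S\leftarrow L},\mathcal{E}_{S\leftarrow L}\circ\mathcal{U}_{L,\theta})$. $\mathfrak{J}:=\min_{h\in\mathbb{H}}\Delta h$, where $\mathbb{H}$ is the set of Hermitian matrices $h=(h_{ij})$ with $H_S=\sum_{ij}h_{ij}K_{S,i}^\dagger K_{S,j}$. The notation $x\gtrsim y$ means $x\ge \ell(y)$ for some function $\ell(y)=y+O(y^2)$. *)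

theory Defs
  imports "HOL-Analysis.Analysis" "HOL-Library.Landau_Symbols"
    "Jordan_Normal_Form.Matrix" "Jordan_Normal_Form.Char_Poly"
begin

text \<open>Finite-dimensional quantum systems: operators on a d-dimensional system are
  complex d x d matrices (Jordan_Normal_Form type complex mat). A composite system
  of dimensions d and r is indexed by pairs (a,x), encoded as a*r + x.\<close>

definition dag :: "complex mat \<Rightarrow> complex mat" where
  "dag A = mat (dim_col A) (dim_row A) (\<lambda>(i,j). cnj (A $$ (j,i)))"

definition tr :: "complex mat \<Rightarrow> complex" where
  "tr A = (\<Sum>i<dim_row A. A $$ (i,i))"

definition hermitian :: "nat \<Rightarrow> complex mat \<Rightarrow> bool" where
  "hermitian n A \<longleftrightarrow> A \<in> carrier_mat n n \<and> dag A = A"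

definition psd :: "nat \<Rightarrow> complex mat \<Rightarrow> bool" where
  "psd n A \<longleftrightarrow> hermitian n A \<and>
     (\<forall>v::nat \<Rightarrow> complex. 0 \<le> Re (\<Sum>i<n. \<Sum>j<n. cnj (v i) * A $$ (i,j) * v j))"

definition density :: "nat \<Rightarrow> complex mat \<Rightarrow> bool" where
  "density n \<rho> \<longleftrightarrow> psd n \<rho> \<and> tr \<rho> = 1"

definition msqrt :: "complex mat \<Rightarrow> complex mat" where
  "msqrt A = (THE B. psd (dim_row A) B \<and> B * B = A)"

definition fidelity :: "complex mat \<Rightarrow> complex mat \<Rightarrow> real" where
  "fidelity \<rho> \<sigma> = Re (tr (msqrt (msqrt \<rho> * \<sigma> * msqrt \<rho>)))"

definition purified_dist :: "complex mat \<Rightarrow> complex mat \<Rightarrow> real" where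
  "purified_dist \<rho> \<sigma> = sqrt (1 - (fidelity \<rho> \<sigma>)\<^sup>2)"

definition mexp :: "complex mat \<Rightarrow> complex mat" where
  "mexp A = mat (dim_row A) (dim_row A) (\<lambda>(i,j). \<Sum>k. (A ^\<^sub>m k) $$ (i,j) / of_nat (fact k))"

definition U1 :: "complex mat \<Rightarrow> real \<Rightarrow> complex mat" where
  "U1 H \<theta> = mexp ((- \<i> * of_real \<theta>) \<cdot>\<^sub>m H)"

definition spread :: "complex mat \<Rightarrow> real" where
  "spread X = Max (Re ` {l. eigenvalue X l}) - Min (Re ` {l. eigenvalue X l})"

definition kraus_channel :: "nat \<Rightarrow> nat \<Rightarrow> complex mat list \<Rightarrow> bool" where
  "kraus_channel din dout Ks \<longleftrightarrow> (\<forall>K\<in>set Ks. K \<in> carrier_mat dout din) \<and>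
     mat din din (\<lambda>(a,b). \<Sum>K\<leftarrow>Ks. (dag K * K) $$ (a,b)) = 1\<^sub>m din"

definition apply_kraus :: "nat \<Rightarrow> complex mat list \<Rightarrow> complex mat \<Rightarrow> complex mat" where
  "apply_kraus dout Ks \<rho> = mat dout dout (\<lambda>(a,b). \<Sum>K\<leftarrow>Ks. (K * \<rho> * dag K) $$ (a,b))"

definition comp_kraus :: "complex mat list \<Rightarrow> complex mat list \<Rightarrow> complex mat list" where
  "comp_kraus Ks2 Ks1 = concat (map (\<lambda>K1. map (\<lambda>K2. K2 * K1) Ks2) Ks1)"

definition kron_id :: "nat \<Rightarrow> complex mat \<Rightarrow> complex mat" where
  "kron_id r K = mat (dim_row K * r) (dim_col K * r)
     (\<lambda>(i,j). if i mod r = j mod r then K $$ (i div r, j div r) else 0)"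

text \<open>Purified distance of channels din -> dout: maximised over states of the input
  together with a reference system (of the same dimension as the input).\<close>
definition chan_pdist :: "nat \<Rightarrow> nat \<Rightarrow> complex mat list \<Rightarrow> complex mat list \<Rightarrow> real" where
  "chan_pdist din dout Ks1 Ks2 = Sup {purified_dist
       (apply_kraus (dout * din) (map (kron_id din) Ks1) \<rho>)
       (apply_kraus (dout * din) (map (kron_id din) Ks2) \<rho>) | \<rho>. density (din * din) \<rho>}"

definition qec_inacc :: "nat \<Rightarrow> nat \<Rightarrow> complex mat \<Rightarrow> complex mat list \<Rightarrow> real" where
  "qec_inacc dL dS V Ks = Inf {chan_pdist dL dL (comp_kraus R (comp_kraus Ks [V])) [1\<^sub>m dL] | R.
       kraus_channel dS dL R}"

definition cov_viol :: "nat \<Rightarrow> nat \<Rightarrow> complex mat \<Rightarrow> complex mat \<Rightarrow> complex mat \<Rightarrow> real" where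
  "cov_viol dL dS V HL HS = Sup {chan_pdist dL dS [U1 HS \<theta> * V] [V * U1 HL \<theta>] | \<theta>. True}"

definition kraus_comb :: "nat \<Rightarrow> complex mat list \<Rightarrow> (nat \<Rightarrow> nat \<Rightarrow> complex) \<Rightarrow> complex mat" where
  "kraus_comb dS Ks c = mat dS dS (\<lambda>(a,b). \<Sum>i<length Ks. \<Sum>j<length Ks.
       c i j * (dag (Ks ! i) * Ks ! j) $$ (a,b))"

definition frakJ :: "nat \<Rightarrow> complex mat list \<Rightarrow> complex mat \<Rightarrow> real" where
  "frakJ dS Ks HS = Inf {spread h | h. hermitian (length Ks) h \<and>
       HS = kraus_comb dS Ks (\<lambda>i j. h $$ (i,j))}"

end

theory Submission
  imports Defs "Jordan_Normal_Form.Schur_Decomposition" "Jordan_Normal_Form.Spectral_Radius"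
begin

text \<open>
  Let \<open>w\<^sub>0\<close>, \<open>w\<^sub>1\<close> be eigenvectors of \<open>H\<^sub>L\<close> for its largest and smallest eigenvalues \<open>l\<^sub>0\<close>, \<open>l\<^sub>1\<close>,
  and probe all channels with the state \<open>\<psi> = (w\<^sub>0 \<otimes> e\<^sub>0 + w\<^sub>1 \<otimes> e\<^sub>1) / \<surd>2\<close> of system and reference.
  Write \<open>\<mu>\<^sub>b\<close> for the mean of \<open>H\<^sub>S\<close> in \<open>V w\<^sub>b\<close>.

  Recovery with fidelity \<open>f\<close> on \<open>\<psi>\<close> forces the dilated outputs of \<open>w\<^sub>0\<close> and \<open>w\<^sub>1\<close> to be close to product
  states \<open>w\<^sub>b \<otimes> \<zeta>\<close> with a common environment state \<open>\<zeta>\<close>. As \<open>\<mu>\<^sub>b\<close> is the expectation of \<open>h\<close> in the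
  environment, \<open>|\<mu>\<^sub>0 - \<mu>\<^sub>1| \<le> 2 \<Delta>h \<surd>(1 - f\<^sup>2)\<close>, hence \<open>|\<mu>\<^sub>0 - \<mu>\<^sub>1| \<le> 2 \<epsilon> J\<close>.

  The overlap of the two sides of the covariance condition on \<open>\<psi>\<close> is the characteristic function
  of the equal mixture of the energy distributions of \<open>V w\<^sub>b\<close> shifted by \<open>l\<^sub>b\<close>. Averaging its squared
  modulus over \<theta> shows that some atom of this mixture has mass \<open>m\<close> with
  \<open>1 - \<delta>\<^sup>2 \<le> m\<^sup>2 + (1 - m)\<^sup>2\<close>. The means of the two shifted distributions differ by at least
  \<open>\<Delta>H\<^sub>L - 2 \<epsilon> J\<close>, whereas concentration on a common atom makes them differ by at most \<open>2 (1 - m) \<Delta>H\<^sub>S\<close>.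
  Eliminating \<open>m\<close> gives \<open>\<delta> \<ge> y - y\<^sup>2\<close> for \<open>y\<^sup>2 = (\<Delta>H\<^sub>L - 2 \<epsilon> J) / \<Delta>H\<^sub>S\<close>.
\<close>

section \<open>Spectral theorem\<close>

lemma index_mult_mat_sum:
  assumes "i < dim_row A" "j < dim_col B" "dim_col A = dim_row B"
  shows "(A * B) $$ (i,j) = (\<Sum>k<dim_row B. A $$ (i,k) * B $$ (k,j))"
  using assms by (auto simp: scalar_prod_def lessThan_atLeast0 intro!: sum.cong)

lemma dim_dag [simp]: "dim_row (dag A) = dim_col A" "dim_col (dag A) = dim_row A"
  by (auto simp: dag_def)

lemma index_dag [simp]: "i < dim_col A \<Longrightarrow> j < dim_row A \<Longrightarrow> dag A $$ (i,j) = cnj (A $$ (j,i))"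
  by (simp add: dag_def)

lemma dag_carrier [simp]: "A \<in> carrier_mat n m \<Longrightarrow> dag A \<in> carrier_mat m n"
  by (auto simp: dag_def)

lemma dag_dag [simp]: "dag (dag A) = A"
  by (rule eq_matI) auto

lemma dag_mult:
  assumes "dim_col A = dim_row B"
  shows "dag (A * B) = dag B * dag A"
  by (rule eq_matI) (use assms in \<open>auto simp: index_mult_mat_sum simp del: index_mult_mat(1) intro!: sum.cong\<close>)

lemma mult_assoc_dim:
  fixes A :: "complex mat"
  assumes "dim_col A = dim_row B" "dim_col B = dim_row C"
  shows "(A * B) * C = A * (B * C)"
  using assms by (intro assoc_mult_mat[of _ "dim_row A" "dim_col A" _ "dim_col B"]) auto

text \<open>Rewriting with \<open>mult_assoc_dim\<close> nests products to the right, so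
  \<open>A\<close> and \<open>B\<close> never form a subterm \<open>A * B\<close>. This form removes
  an inverse pair inside such a nested product.\<close>

lemma mult_left_cancel:
  fixes A :: "complex mat"
  assumes "A * B = 1\<^sub>m n" "dim_col A = dim_row B" "dim_col B = dim_row X" "dim_row X = n"
  shows "A * (B * X) = X"
  using assms by (metis mult_assoc_dim left_mult_one_mat carrier_matI)

definition diagm :: "nat \<Rightarrow> (nat \<Rightarrow> complex) \<Rightarrow> complex mat" where
  "diagm n d = mat n n (\<lambda>(i,j). if i = j then d i else 0)"

lemma diagm_carrier [simp]: "diagm n d \<in> carrier_mat n n"
  and dim_diagm [simp]: "dim_row (diagm n d) = n" "dim_col (diagm n d) = n"
  by (auto simp: diagm_def)

lemma sum_lessThan_single:
  fixes f :: "nat \<Rightarrow> 'a::comm_monoid_add"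
  assumes "i < n" "\<And>k. k < n \<Longrightarrow> k \<noteq> i \<Longrightarrow> f k = 0"
  shows "(\<Sum>k<n. f k) = f i"
  using assms sum.mono_neutral_right[of "{..<n}" "{i}" f] by auto

lemma index_diagm_mult:
  assumes "A \<in> carrier_mat n m" "i < n" "j < m"
  shows "(diagm n d * A) $$ (i,j) = d i * A $$ (i,j)"
  using assms by (subst index_mult_mat_sum; simp) (subst sum_lessThan_single[of i], auto simp: diagm_def)

lemma index_mult_diagm:
  assumes "A \<in> carrier_mat m n" "i < m" "j < n"
  shows "(A * diagm n d) $$ (i,j) = A $$ (i,j) * d j"
  using assms by (subst index_mult_mat_sum; simp) (subst sum_lessThan_single[of j], auto simp: diagm_def)

lemma index_conj_diagm:
  assumes "U \<in> carrier_mat n n" "i < n" "j < n"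
  shows "(U * diagm n d * dag U) $$ (i,j) = (\<Sum>k<n. U $$ (i,k) * d k * cnj (U $$ (j,k)))"
proof -
  have "(U * diagm n d) $$ (i,k) = U $$ (i,k) * d k" if k: "k < n" for k
    using index_mult_diagm[OF assms(1,2) k] .
  then show ?thesis
    using assms by (subst index_mult_mat_sum) (auto simp del: index_mult_mat(1) intro!: sum.cong)
qed

lemma diagm_mult: "diagm n d * diagm n e = diagm n (\<lambda>i. d i * e i)"
proof (rule eq_matI)
  fix i j assume "i < dim_row (diagm n (\<lambda>i. d i * e i))" "j < dim_col (diagm n (\<lambda>i. d i * e i))"
  then have ij: "i < n" "j < n" by auto
  then show "(diagm n d * diagm n e) $$ (i,j) = diagm n (\<lambda>i. d i * e i) $$ (i,j)"
    unfolding index_diagm_mult[OF diagm_carrier ij] by (simp add: diagm_def)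
qed auto

lemma dag_diagm: "dag (diagm n d) = diagm n (\<lambda>i. cnj (d i))"
  by (rule eq_matI) (auto simp: diagm_def)

lemma diagm_const: "diagm n (\<lambda>_. c) = c \<cdot>\<^sub>m 1\<^sub>m n"
  by (rule eq_matI) (auto simp: diagm_def)

definition unitary :: "nat \<Rightarrow> complex mat \<Rightarrow> bool" where
  "unitary n U \<longleftrightarrow> U \<in> carrier_mat n n \<and> dag U * U = 1\<^sub>m n \<and> U * dag U = 1\<^sub>m n"

lemma unitaryI: "U \<in> carrier_mat n n \<Longrightarrow> dag U * U = 1\<^sub>m n \<Longrightarrow> unitary n U"
  unfolding unitary_def using mat_mult_left_right_inverse[of "dag U" n U] by auto

lemma unitary_mult:
  assumes "unitary n U" "unitary n W"
  shows "unitary n (U * W)"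
proof (rule unitaryI)
  have U: "U \<in> carrier_mat n n" "dag U * U = 1\<^sub>m n" and W: "W \<in> carrier_mat n n" "dag W * W = 1\<^sub>m n"
    using assms by (auto simp: unitary_def)
  show "U * W \<in> carrier_mat n n" using U W by auto
  show "dag (U * W) * (U * W) = 1\<^sub>m n"
    using U W by (simp add: dag_mult mult_assoc_dim mult_left_cancel[of "dag U" U n])
qed

text \<open>Gram-Schmidt applied to a basis that starts with \<open>v\<close> keeps \<open>v\<close>
  in first place. It yields orthogonal vectors of arbitrary length, so each column is divided by its
  norm \<open>r j\<close>; the scalar \<open>c\<close> is \<open>1 / r 0\<close>.\<close>

lemma unitary_first_column_exists:
  assumes v: "v \<in> carrier_vec n" "v \<noteq> 0\<^sub>v n"
  obtains W c where "unitary n W" "col W 0 = c \<cdot>\<^sub>v v"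
proof -
  define ws where "ws = gram_schmidt n (basis_completion v)"
  interpret cof_vec_space n "TYPE(complex)" .
  note bc = basis_completion[OF v]
  have ws: "set ws \<subseteq> carrier_vec n" "corthogonal ws" "length ws = n"
    using gram_schmidt_result[OF bc(2) bc(4) bc(5) ws_def] bc(6) by auto
  have n: "n > 0" using v by (cases n) auto
  have hd: "ws ! 0 = v"
  proof -
    have "hd ws = v"
      using gram_schmidt_hd[OF v(1), of "tl (basis_completion v)"] bc(6,7) n
      by (cases "basis_completion v") (auto simp: ws_def)
    then show ?thesis using ws(3) n by (simp add: hd_conv_nth length_greater_0_conv[symmetric] del: length_greater_0_conv)
  qed
  define r where "r j = sqrt (\<Sum>i<n. (cmod (vec_index (ws ! j) i))\<^sup>2)" for j
  define W where "W = mat n n (\<lambda>(i,j). vec_index (ws ! j) i / of_real (r j))"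
  have ip: "(\<Sum>k<n. vec_index (ws ! i) k * cnj (vec_index (ws ! j) k)) = (if i = j then of_real ((r j)\<^sup>2) else 0)" 
    and r0: "i = j \<Longrightarrow> r j \<noteq> 0"
    if "i < n" "j < n" for i j
  proof -
    have c: "ws ! i \<in> carrier_vec n" "ws ! j \<in> carrier_vec n" using ws that by auto
    have *: "ws ! i \<bullet>c ws ! j = (\<Sum>k<n. vec_index (ws ! i) k * cnj (vec_index (ws ! j) k))"
      using c by (auto simp: scalar_prod_def lessThan_atLeast0 intro!: sum.cong)
    have **: "(\<Sum>k<n. vec_index (ws ! j) k * cnj (vec_index (ws ! j) k)) = of_real ((r j)\<^sup>2)"
      by (simp add: r_def sum_nonneg complex_norm_square[symmetric])
    show "(\<Sum>k<n. vec_index (ws ! i) k * cnj (vec_index (ws ! j) k)) = (if i = j then of_real ((r j)\<^sup>2) else 0)"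
      using corthogonalD[OF ws(2), of i j] that ws(3) * ** by auto
    show "i = j \<Longrightarrow> r j \<noteq> 0"
      using corthogonalD[OF ws(2), of i j] that ws(3) * ** by auto
  qed
  have "dag W * W = 1\<^sub>m n"
  proof (rule eq_matI)
    fix i j assume "i < dim_row (1\<^sub>m n :: complex mat)" "j < dim_col (1\<^sub>m n :: complex mat)"
    then have ij: "i < n" "j < n" by auto
    have "(dag W * W) $$ (i,j) = (\<Sum>k<n. vec_index (ws ! j) k * cnj (vec_index (ws ! i) k)) / (of_real (r i) * of_real (r j))"
      using ij by (auto simp: index_mult_mat_sum W_def sum_divide_distrib mult_ac simp del: index_mult_mat(1) intro!: sum.cong)
    then show "(dag W * W) $$ (i,j) = 1\<^sub>m n $$ (i,j)"
      using ij r0[of j j] by (simp add: ip power2_eq_square)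
  qed (auto simp: W_def)
  then have "unitary n W" by (intro unitaryI) (auto simp: W_def)
  moreover have "col W 0 = (1 / of_real (r 0)) \<cdot>\<^sub>v v"
    by (rule eq_vecI) (use n v in \<open>auto simp: W_def hd\<close>)
  ultimately show ?thesis using that by blast
qed

lemma hermitian_conj:
  assumes "hermitian n A" "W \<in> carrier_mat n m"
  shows "hermitian m (dag W * A * W)"
proof -
  have A: "A \<in> carrier_mat n n" "dag A = A" using assms by (auto simp: hermitian_def)
  have "dag (dag W * A * W) = dag W * (A * W)"
    using A assms(2) by (subst dag_mult, simp, subst dag_mult) auto
  also have "\<dots> = dag W * A * W" using A assms(2) by (simp add: assoc_mult_mat[of _ m n _ n _ m])
  finally show ?thesis using A assms(2) by (auto simp: hermitian_def)
qed

lemma hermitian_index: "hermitian n A \<Longrightarrow> i < n \<Longrightarrow> j < n \<Longrightarrow> cnj (A $$ (i,j)) = A $$ (j,i)"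
  unfolding hermitian_def by (metis carrier_matD index_dag)

text \<open>Deflation by induction on the dimension: in a basis whose first vector is an
  eigenvector, the first column vanishes below the diagonal, hermiticity clears the first row, and
  the remaining block is again hermitian.\<close>

lemma hermitian_spectral:
  assumes "hermitian n A"
  obtains U and d :: "nat \<Rightarrow> real" where "unitary n U" "A = U * diagm n (\<lambda>i. of_real (d i)) * dag U"
proof -
  have "\<exists>U (d :: nat \<Rightarrow> real). unitary n U \<and> A = U * diagm n (\<lambda>i. of_real (d i)) * dag U"
    using assms
  proof (induction n arbitrary: A)
    case 0
    then have "A \<in> carrier_mat 0 0" by (simp add: hermitian_def)
    then show ?case
      by (intro exI[of _ "1\<^sub>m 0"] exI[of _ "\<lambda>_. 0"]) (auto simp: unitary_def intro!: eq_matI)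
  next
    case (Suc m)
    let ?n = "Suc m"
    have A: "A \<in> carrier_mat ?n ?n" "dag A = A" using Suc.prems by (auto simp: hermitian_def)
    obtain e where "eigenvalue A e"
      using spectrum_non_empty[OF A(1)] by (auto simp: spectrum_def)
    then obtain v where v: "v \<in> carrier_vec ?n" "v \<noteq> 0\<^sub>v ?n" "A *\<^sub>v v = e \<cdot>\<^sub>v v"
      using A by (auto simp: eigenvalue_def eigenvector_def)
    obtain W c where W: "unitary ?n W" "col W 0 = c \<cdot>\<^sub>v v"
      using unitary_first_column_exists[OF v(1,2)] .
    have Wc: "W \<in> carrier_mat ?n ?n" "dag W * W = 1\<^sub>m ?n" "W * dag W = 1\<^sub>m ?n"
      using W by (auto simp: unitary_def)
    define B where "B = dag W * A * W"
    have hB: "hermitian ?n B" unfolding B_def by (rule hermitian_conj[OF Suc.prems Wc(1)])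
    have Bc: "B \<in> carrier_mat ?n ?n" using hB by (simp add: hermitian_def)
    have AB: "A = W * B * dag W"
      unfolding B_def using A Wc by (simp add: mult_assoc_dim mult_left_cancel[of W "dag W" ?n])
    have col0: "B $$ (i,0) = (if i = 0 then e else 0)" if "i < ?n" for i
    proof -
      have "A *\<^sub>v col W 0 = e \<cdot>\<^sub>v col W 0"
        using v A by (simp add: W(2) mult_mat_vec smult_smult_assoc mult.commute)
      then have "col (A * W) 0 = e \<cdot>\<^sub>v col W 0"
        by (metis A(1) Wc(1) col_mult2 zero_less_Suc)
      then have AW: "(A * W) $$ (k,0) = e * W $$ (k,0)" if "k < ?n" for k
        using that A Wc index_col[of k "A * W" 0] index_col[of k W 0] 
        by (auto simp del: index_mult_mat(1) index_col)
      have "B $$ (i,0) = (dag W * (A * W)) $$ (i,0)"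
        unfolding B_def using A Wc by (simp add: assoc_mult_mat[of _ ?n ?n _ ?n _ ?n])
      also have "\<dots> = (\<Sum>k<?n. dag W $$ (i,k) * (A * W) $$ (k,0))"
        using A Wc that by (subst index_mult_mat_sum) auto
      also have "\<dots> = (\<Sum>k<?n. dag W $$ (i,k) * (e * W $$ (k,0)))"
        using AW by (intro sum.cong) auto
      also have "\<dots> = e * (\<Sum>k<?n. dag W $$ (i,k) * W $$ (k,0))"
        by (simp only: sum_distrib_left mult_ac)
      also have "(\<Sum>k<?n. dag W $$ (i,k) * W $$ (k,0)) = (dag W * W) $$ (i,0)"
        using Wc that by (subst index_mult_mat_sum) auto
      finally show ?thesis using that by (simp add: Wc)
    qed
    \<comment> \<open>The eigenvalue is a diagonal entry of a hermitian matrix, hence real, so it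
      can be stored in the real-valued \<open>d\<close>.\<close>
    have e_real: "cnj e = e" using hermitian_index[OF hB, of 0 0] col0[of 0] by simp
    define C where "C = mat m m (\<lambda>(i,j). B $$ (Suc i, Suc j))"
    have hC: "hermitian m C"
      unfolding hermitian_def by (auto simp: C_def hermitian_index[OF hB] intro!: eq_matI)
    from Suc.IH[OF hC] obtain U' and d' :: "nat \<Rightarrow> real" where
      U': "unitary m U'" and CU: "C = U' * diagm m (\<lambda>i. of_real (d' i)) * dag U'" by blast
    have U'c: "U' \<in> carrier_mat m m" "dag U' * U' = 1\<^sub>m m" using U' by (auto simp: unitary_def)
    define d where "d = case_nat (Re e) d'"
    \<comment> \<open>\<open>X\<close> is the block sum of the scalar 1 and \<open>U'\<close>; it
      diagonalises \<open>B\<close>, so \<open>W * X\<close> diagonalises \<open>A\<close>.\<close>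
    define X where "X = mat ?n ?n (\<lambda>(i,j). case i of 0 \<Rightarrow> if j = 0 then 1 else 0 
        | Suc i' \<Rightarrow> (case j of 0 \<Rightarrow> 0 | Suc j' \<Rightarrow> U' $$ (i',j')))"
    have Xc: "X \<in> carrier_mat ?n ?n" by (simp add: X_def)
    have "dag X * X = 1\<^sub>m ?n"
    proof (rule eq_matI)
      fix i j assume "i < dim_row (1\<^sub>m ?n :: complex mat)" "j < dim_col (1\<^sub>m ?n :: complex mat)"
      then have ij: "i < ?n" "j < ?n" by auto
      have *: "(dag X * X) $$ (i,j) = (\<Sum>k<?n. cnj (X $$ (k,i)) * X $$ (k,j))"
        using ij Xc by (subst index_mult_mat_sum) auto
      show "(dag X * X) $$ (i,j) = 1\<^sub>m ?n $$ (i,j)"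
      proof (cases i; cases j)
        fix i' j' assume [simp]: "i = Suc i'" "j = Suc j'"
        have "(dag X * X) $$ (i,j) = (\<Sum>k<m. cnj (U' $$ (k,i')) * U' $$ (k,j'))"
          unfolding * sum.lessThan_Suc_shift using ij by (auto simp: X_def intro!: sum.cong)
        also have "\<dots> = (dag U' * U') $$ (i',j')"
          using ij U'c by (subst index_mult_mat_sum) auto
        finally show ?thesis using ij U'c by simp
      qed (use ij in \<open>unfold * sum.lessThan_Suc_shift, simp_all add: X_def\<close>)
    qed (use Xc in auto)
    then have X: "unitary ?n X" using Xc by (intro unitaryI)
    have BX: "B = X * diagm ?n (\<lambda>i. of_real (d i)) * dag X"
    proof (rule eq_matI)
      fix i j assume "i < dim_row (X * diagm ?n (\<lambda>i. of_real (d i)) * dag X)" 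
         "j < dim_col (X * diagm ?n (\<lambda>i. of_real (d i)) * dag X)"
      then have ij: "i < ?n" "j < ?n" using Xc by auto
      note dX = index_conj_diagm[OF Xc ij]
      show "B $$ (i,j) = (X * diagm ?n (\<lambda>i. of_real (d i)) * dag X) $$ (i,j)"
      proof (cases i; cases j)
        fix i' j' assume [simp]: "i = Suc i'" "j = Suc j'"
        have "B $$ (i,j) = C $$ (i',j')" using ij by (simp add: C_def)
        also have "\<dots> = (\<Sum>k<m. U' $$ (i',k) * of_real (d' k) * cnj (U' $$ (j',k)))"
          unfolding CU using ij U'c by (subst index_conj_diagm) auto
        also have "\<dots> = (\<Sum>k<?n. X $$ (i,k) * of_real (d k) * cnj (X $$ (j,k)))"
          unfolding sum.lessThan_Suc_shift using ij by (auto simp: X_def d_def intro!: sum.cong)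
        finally show ?thesis using dX by simp
      next
        assume "i = 0" "j = 0"
        then show ?thesis unfolding dX sum.lessThan_Suc_shift using col0[of 0] e_real
          by (simp add: X_def d_def Reals_cnj_iff)
      next
        fix i' assume "i = Suc i'" "j = 0"
        then show ?thesis unfolding dX sum.lessThan_Suc_shift using ij col0[of i] by (simp add: X_def)
      next
        fix j' assume "i = 0" "j = Suc j'"
        then show ?thesis unfolding dX sum.lessThan_Suc_shift
          using ij col0[of j] hermitian_index[OF hB, of j 0] by (simp add: X_def)
      qed
    qed (use Xc Bc in auto)
    have "A = (W * X) * diagm ?n (\<lambda>i. of_real (d i)) * dag (W * X)"
      unfolding AB BX using Wc Xc
      by (simp add: dag_mult mult_assoc_dim)
    then show ?case using unitary_mult[OF W(1) X] by blast
  qed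
  then show ?thesis using that by blast
qed

section \<open>Square roots and fidelity with a pure state\<close>

definition ip :: "nat \<Rightarrow> (nat \<Rightarrow> complex) \<Rightarrow> (nat \<Rightarrow> complex) \<Rightarrow> complex" where
  "ip n x y = (\<Sum>i<n. cnj (x i) * y i)"

text \<open>The value 0 beyond the rows makes laws such as \<open>mv_mult\<close> equalities of
  functions, without a bound on the index.\<close>

definition mv :: "complex mat \<Rightarrow> (nat \<Rightarrow> complex) \<Rightarrow> nat \<Rightarrow> complex" where
  "mv A x = (\<lambda>i. if i < dim_row A then \<Sum>j<dim_col A. A $$ (i,j) * x j else 0)"

definition nsq :: "nat \<Rightarrow> (nat \<Rightarrow> complex) \<Rightarrow> real" where
  "nsq n x = (\<Sum>i<n. (cmod (x i))\<^sup>2)"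

definition ketbra :: "nat \<Rightarrow> (nat \<Rightarrow> complex) \<Rightarrow> complex mat" where
  "ketbra n x = mat n n (\<lambda>(i,j). x i * cnj (x j))"

lemma ip_cong: "(\<And>i. i < n \<Longrightarrow> x i = x' i) \<Longrightarrow> (\<And>i. i < n \<Longrightarrow> y i = y' i) \<Longrightarrow> ip n x y = ip n x' y'"
  by (simp add: ip_def)

lemma nsq_nonneg: "nsq n x \<ge> 0"
  by (simp add: nsq_def sum_nonneg)

lemma ip_self: "ip n x x = of_real (nsq n x)"
  by (simp add: ip_def nsq_def complex_norm_square[symmetric] mult.commute)

lemma cnj_ip: "cnj (ip n x y) = ip n y x"
  by (simp add: ip_def mult.commute)

lemma mv_cong: "(\<And>i. i < dim_col A \<Longrightarrow> x i = y i) \<Longrightarrow> mv A x = mv A y"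
  by (rule ext) (simp add: mv_def)

lemma mv_mult:
  assumes "dim_col A = dim_row B"
  shows "mv (A * B) x = mv A (mv B x)"
proof
  fix i
  show "mv (A * B) x i = mv A (mv B x) i"
  proof (cases "i < dim_row A")
    case True
    have "mv (A * B) x i = (\<Sum>j<dim_col B. \<Sum>k<dim_row B. A $$ (i,k) * B $$ (k,j) * x j)"
      using True assms by (simp add: mv_def index_mult_mat_sum sum_distrib_right del: index_mult_mat(1))
    also have "\<dots> = (\<Sum>k<dim_row B. \<Sum>j<dim_col B. A $$ (i,k) * B $$ (k,j) * x j)"
      by (rule sum.swap)
    also have "\<dots> = mv A (mv B x) i"
      using True assms by (simp add: mv_def sum_distrib_left mult.assoc)
    finally show ?thesis .
  qed (simp add: mv_def)
qed

lemma mv_one: "i < n \<Longrightarrow> mv (1\<^sub>m n) x i = x i"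
  by (simp add: mv_def, subst sum_lessThan_single[of i]) auto

lemma mv_diagm: "i < n \<Longrightarrow> mv (diagm n d) x i = d i * x i"
  by (simp add: mv_def, subst sum_lessThan_single[of i]) (auto simp: diagm_def)

lemma ip_mv:
  assumes "A \<in> carrier_mat m n"
  shows "ip m x (mv A y) = ip n (mv (dag A) x) y"
proof -
  have "ip m x (mv A y) = (\<Sum>i<m. \<Sum>j<n. cnj (x i) * A $$ (i,j) * y j)"
    using assms by (simp add: ip_def mv_def sum_distrib_left mult.assoc)
  also have "\<dots> = (\<Sum>j<n. \<Sum>i<m. cnj (x i) * A $$ (i,j) * y j)"
    by (rule sum.swap)
  also have "\<dots> = ip n (mv (dag A) x) y"
    using assms by (auto simp: ip_def mv_def sum_distrib_right sum_distrib_left mult_ac intro!: sum.cong)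
  finally show ?thesis .
qed

lemma psd_alt: "psd n A \<longleftrightarrow> hermitian n A \<and> (\<forall>v. 0 \<le> Re (ip n v (mv A v)))"
proof (cases "hermitian n A")
  case True
  then have "(\<Sum>i<n. \<Sum>j<n. cnj (v i) * A $$ (i,j) * v j) = ip n v (mv A v)" for v
    by (auto simp: hermitian_def ip_def mv_def sum_distrib_left mult.assoc intro!: sum.cong)
  then show ?thesis by (simp add: psd_def)
qed (simp add: psd_def)

lemma ip_conj_diagm:
  assumes "U \<in> carrier_mat n n"
  shows "ip n x (mv (U * diagm n d * dag U) y) = (\<Sum>k<n. cnj (mv (dag U) x k) * d k * mv (dag U) y k)"
proof -
  have "ip n x (mv (U * diagm n d * dag U) y) = ip n x (mv U (mv (diagm n d) (mv (dag U) y)))"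
    using assms by (simp add: mv_mult)
  also have "\<dots> = ip n (mv (dag U) x) (mv (diagm n d) (mv (dag U) y))"
    by (rule ip_mv[OF assms])
  also have "\<dots> = (\<Sum>k<n. cnj (mv (dag U) x k) * d k * mv (dag U) y k)"
    by (simp add: ip_def mv_diagm mult.assoc)
  finally show ?thesis .
qed

lemma hermitian_conj_diagm:
  assumes "U \<in> carrier_mat n n" 
  shows "hermitian n (U * diagm n (\<lambda>i. of_real (d i)) * dag U)"
  using assms by (auto simp: hermitian_def dag_mult dag_diagm mult_assoc_dim)

lemma psd_conj_diagm:
  assumes "U \<in> carrier_mat n n" "\<And>i. i < n \<Longrightarrow> d i \<ge> 0"
  shows "psd n (U * diagm n (\<lambda>i. of_real (d i)) * dag U)"
proof -
  have "0 \<le> Re (cnj z * of_real (d i) * z)" if "i < n" for z i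
  proof -
    have "cnj z * of_real (d i) * z = of_real (d i * (cmod z)\<^sup>2)"
      by (simp add: complex_norm_square[symmetric] mult_ac)
    then show ?thesis using assms(2)[OF that] by (simp only: Re_complex_of_real) simp
  qed
  then show ?thesis
    using assms(1) unfolding psd_alt ip_conj_diagm[OF assms(1)] Re_sum
    by (auto intro!: sum_nonneg hermitian_conj_diagm simp del: times_complex.sel)
qed

text \<open>Each eigenvalue \<open>d k\<close> is the value of the quadratic form at column
  \<open>k\<close> of \<open>U\<close>, hence nonnegative.\<close>

lemma psd_spectral:
  assumes "psd n A"
  obtains U and d :: "nat \<Rightarrow> real" where "unitary n U" "A = U * diagm n (\<lambda>i. of_real (d i)) * dag U"
    "\<And>i. i < n \<Longrightarrow> d i \<ge> 0"
proof -
  have "hermitian n A" using assms by (simp add: psd_def)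
  then obtain U and d :: "nat \<Rightarrow> real" where U: "unitary n U" and 
    A: "A = U * diagm n (\<lambda>i. of_real (d i)) * dag U" using hermitian_spectral by blast
  have Uc: "U \<in> carrier_mat n n" "dag U * U = 1\<^sub>m n" using U by (auto simp: unitary_def)
  have "d k \<ge> 0" if k: "k < n" for k
  proof -
    define e :: "nat \<Rightarrow> complex" where "e = (\<lambda>i. if i = k then 1 else 0)"
    have "mv (dag U) (mv U e) i = e i" if "i < n" for i
    proof -
      have "mv (dag U) (mv U e) = mv (dag U * U) e" using Uc(1) by (simp add: mv_mult)
      then show ?thesis using Uc(2) that by (simp add: mv_one)
    qed
    then have "ip n (mv U e) (mv A (mv U e)) = (\<Sum>i<n. if i = k then of_real (d k) else 0)"
      unfolding A ip_conj_diagm[OF Uc(1)] by (intro sum.cong) (auto simp: e_def)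
    also have "\<dots> = of_real (d k)" using k by simp
    finally show ?thesis using assms unfolding psd_alt by (metis Re_complex_of_real)
  qed
  then show ?thesis using that U A by blast
qed

text \<open>Let \<open>G\<close> be the change of basis between the eigenbases of \<open>B\<close>
  and \<open>C\<close>. Equal squares say that \<open>G $$ (i,j)\<close> vanishes unless the squared
  eigenvalues \<open>b i\<close> and \<open>c j\<close> agree; being nonnegative, the eigenvalues
  then agree themselves. This makes the \<open>THE\<close> in \<open>msqrt\<close> well
  defined.\<close>

lemma psd_sqrt_unique:
  assumes "psd n B" "psd n C" "B * B = C * C"
  shows "B = C"
proof -
  obtain U and b :: "nat \<Rightarrow> real" where U: "unitary n U" and 
    B: "B = U * diagm n (\<lambda>i. of_real (b i)) * dag U" and b: "\<And>i. i < n \<Longrightarrow> b i \<ge> 0"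
    using psd_spectral[OF assms(1)] by blast
  obtain W and c :: "nat \<Rightarrow> real" where W: "unitary n W" and 
    C: "C = W * diagm n (\<lambda>i. of_real (c i)) * dag W" and c: "\<And>i. i < n \<Longrightarrow> c i \<ge> 0"
    using psd_spectral[OF assms(2)] by blast
  let ?b = "diagm n (\<lambda>i. of_real (b i))" and ?c = "diagm n (\<lambda>i. of_real (c i))"
  have Uc: "U \<in> carrier_mat n n" "dag U * U = 1\<^sub>m n" "U * dag U = 1\<^sub>m n" using U by (auto simp: unitary_def)
  have Wc: "W \<in> carrier_mat n n" "dag W * W = 1\<^sub>m n" "W * dag W = 1\<^sub>m n" using W by (auto simp: unitary_def)
  define G where "G = dag U * W"
  have G: "G \<in> carrier_mat n n" using Uc(1) Wc(1) unfolding G_def by (intro mult_carrier_mat dag_carrier)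
  note canc = mult_left_cancel[OF Uc(2)] mult_left_cancel[OF Uc(3)] mult_left_cancel[OF Wc(2)] mult_left_cancel[OF Wc(3)]
  have "?b * (?b * G) = dag U * (B * B) * W"
    unfolding B G_def using Uc(1) Wc(1) by (simp add: mult_assoc_dim canc)
  also have "\<dots> = G * (?c * ?c)"
    unfolding assms(3) unfolding C G_def using Uc(1) Wc by (simp add: mult_assoc_dim canc)
  finally have sq: "?b * (?b * G) = G * (?c * ?c)" .
  have bc: "?b * G = G * ?c"
  proof (rule eq_matI)
    fix i j assume "i < dim_row (G * ?c)" "j < dim_col (G * ?c)"
    then have ij: "i < n" "j < n" using G by auto
    have bG: "?b * G \<in> carrier_mat n n" by (rule mult_carrier_mat[OF diagm_carrier G])
    have "of_real (b i) * (of_real (b i) * G $$ (i,j)) = G $$ (i,j) * (of_real (c j) * of_real (c j))"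
      using arg_cong[OF sq, of "\<lambda>M. M $$ (i,j)"] 
      unfolding diagm_mult index_diagm_mult[OF bG ij] index_diagm_mult[OF G ij] index_mult_diagm[OF G ij] .
    then have "G $$ (i,j) = 0 \<or> complex_of_real ((b i)\<^sup>2) = of_real ((c j)\<^sup>2)"
      by (auto simp: power2_eq_square algebra_simps)
    then have "G $$ (i,j) = 0 \<or> b i = c j"
      using b[OF ij(1)] c[OF ij(2)] by (auto simp only: of_real_eq_iff power2_eq_iff_nonneg)
    then show "(?b * G) $$ (i,j) = (G * ?c) $$ (i,j)"
      unfolding index_diagm_mult[OF G ij] index_mult_diagm[OF G ij] by auto
  qed (use G in auto)
  have "B = U * (?b * G) * dag W"
    unfolding B G_def using Uc(1) Wc by (simp add: mult_assoc_dim)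
  also have "\<dots> = C"
    unfolding bc unfolding C G_def using Uc Wc(1) by (simp add: mult_assoc_dim canc)
  finally show ?thesis .
qed

lemma msqrt_eqI:
  assumes "psd n B" "B * B = A"
  shows "msqrt A = B"
proof -
  have d: "dim_row A = n" using assms by (auto simp: psd_def hermitian_def)
  show ?thesis unfolding msqrt_def d
    by (rule the_equality) (use assms psd_sqrt_unique in auto)
qed

lemma msqrt_psd:
  assumes "psd n A"
  shows "psd n (msqrt A)" "msqrt A * msqrt A = A"
proof -
  obtain U and d :: "nat \<Rightarrow> real" where U: "unitary n U" and 
    A: "A = U * diagm n (\<lambda>i. of_real (d i)) * dag U" and d: "\<And>i. i < n \<Longrightarrow> d i \<ge> 0"
    using psd_spectral[OF assms] by blast
  have Uc: "U \<in> carrier_mat n n" "dag U * U = 1\<^sub>m n" using U by (auto simp: unitary_def)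
  define S where "S = U * diagm n (\<lambda>i. of_real (sqrt (d i))) * dag U"
  have S: "psd n S" unfolding S_def by (rule psd_conj_diagm) (use Uc d in auto)
  have "diagm n (\<lambda>i. of_real (sqrt (d i))) * diagm n (\<lambda>i. of_real (sqrt (d i))) 
     = diagm n (\<lambda>i. complex_of_real (d i))"
    unfolding diagm_mult by (rule eq_matI) (auto simp: diagm_def d simp flip: of_real_mult)
  moreover have "S * S = U * (diagm n (\<lambda>i. of_real (sqrt (d i))) * diagm n (\<lambda>i. of_real (sqrt (d i)))) * dag U"
    unfolding S_def using Uc by (simp add: mult_assoc_dim mult_left_cancel[OF Uc(2)])
  ultimately have SS: "S * S = A" by (simp add: A)
  show "psd n (msqrt A)" "msqrt A * msqrt A = A"
    using msqrt_eqI[OF S SS] S SS by auto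
qed

section \<open>Rank-one operators and their square roots\<close>

lemma ketbra_carrier [simp]: "ketbra n x \<in> carrier_mat n n"
  and dim_ketbra [simp]: "dim_row (ketbra n x) = n" "dim_col (ketbra n x) = n"
  by (auto simp: ketbra_def)

lemma mv_ketbra: "i < n \<Longrightarrow> mv (ketbra n x) y i = x i * ip n x y"
  by (simp add: mv_def ketbra_def ip_def sum_distrib_left mult.assoc)

lemma psd_ketbra: "psd n (ketbra n x)"
proof -
  have "ip n y (mv (ketbra n x) y) = of_real ((cmod (ip n x y))\<^sup>2)" for y
  proof -
    have "ip n y (mv (ketbra n x) y) = (\<Sum>i<n. cnj (y i) * x i * ip n x y)"
      by (simp add: ip_def[of n y] mv_ketbra mult.assoc)
    also have "\<dots> = ip n y x * ip n x y" by (simp add: ip_def[of n y] sum_distrib_right)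
    also have "\<dots> = cnj (ip n x y) * ip n x y" by (simp only: cnj_ip)
    finally show ?thesis by (simp add: complex_norm_square[symmetric] mult.commute)
  qed
  then show ?thesis unfolding psd_alt hermitian_def
    by (auto simp: ketbra_def intro!: eq_matI)
qed

lemma ketbra_mult_self: "ketbra n x * ketbra n x = of_real (nsq n x) \<cdot>\<^sub>m ketbra n x"
proof (rule eq_matI)
  fix i j assume "i < dim_row (of_real (nsq n x) \<cdot>\<^sub>m ketbra n x)" "j < dim_col (of_real (nsq n x) \<cdot>\<^sub>m ketbra n x)"
  then have ij: "i < n" "j < n" by auto
  have "(ketbra n x * ketbra n x) $$ (i,j) = (\<Sum>k<n. (x i * cnj (x j)) * (cnj (x k) * x k))"
    using ij by (subst index_mult_mat_sum) (auto simp: ketbra_def intro!: sum.cong)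
  also have "\<dots> = (x i * cnj (x j)) * ip n x x" by (simp only: ip_def sum_distrib_left)
  finally show "(ketbra n x * ketbra n x) $$ (i,j) = (of_real (nsq n x) \<cdot>\<^sub>m ketbra n x) $$ (i,j)"
    using ij by (simp add: ketbra_def ip_self del: index_mult_mat(1))
qed auto

lemma ketbra_conj:
  assumes "K \<in> carrier_mat m n"
  shows "K * ketbra n x * dag K = ketbra m (mv K x)"
proof (rule eq_matI)
  fix i j assume "i < dim_row (ketbra m (mv K x))" "j < dim_col (ketbra m (mv K x))"
  then have ij: "i < m" "j < m" by auto
  have 1: "(K * ketbra n x) $$ (i,k) = mv K x i * cnj (x k)" if "k < n" for k
    using assms ij that by (subst index_mult_mat_sum) (auto simp: ketbra_def mv_def sum_distrib_right mult.assoc)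
  have "(K * ketbra n x * dag K) $$ (i,j) = (\<Sum>k<n. mv K x i * cnj (x k) * cnj (K $$ (j,k)))"
    using assms ij by (subst index_mult_mat_sum) (auto simp: 1 simp del: index_mult_mat(1) intro!: sum.cong)
  also have "\<dots> = mv K x i * cnj (mv K x j)"
    using assms ij by (simp add: mv_def[of K x] sum_distrib_left mult_ac)
  finally show "(K * ketbra n x * dag K) $$ (i,j) = ketbra m (mv K x) $$ (i,j)"
    using ij by (simp add: ketbra_def del: index_mult_mat(1))
qed (use assms in auto)

lemma tr_ketbra: "tr (ketbra n x) = of_real (nsq n x)"
proof -
  have "tr (ketbra n x) = ip n x x" by (simp add: tr_def ip_def ketbra_def mult.commute)
  then show ?thesis by (simp add: ip_self)
qed

lemma nsq_scale: "nsq n (\<lambda>i. of_real c * x i) = c\<^sup>2 * nsq n x"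
  by (simp add: nsq_def sum_distrib_left norm_mult power_mult_distrib)

lemma tr_msqrt_ketbra: "tr (msqrt (ketbra n x)) = of_real (sqrt (nsq n x))"
proof (cases "nsq n x = 0")
  case True
  then have x0: "x i = 0" if "i < n" for i
    using that by (simp add: nsq_def sum_nonneg_eq_0_iff)
  have "msqrt (ketbra n x) = ketbra n x"
    by (rule msqrt_eqI[OF psd_ketbra], unfold ketbra_mult_self) (auto simp: True x0 ketbra_def intro!: eq_matI)
  then show ?thesis by (simp add: tr_ketbra True)
next
  case False
  define r where "r = sqrt (nsq n x)"
  have r: "r > 0" "r\<^sup>2 = nsq n x" using False nsq_nonneg[of n x] by (auto simp: r_def)
  \<comment> \<open>With \<open>r\<close> the norm of \<open>x\<close>, this scaling gives
    \<open>nsq n y = r\<close>, so the square of \<open>ketbra n y\<close> is \<open>r\<close> times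
    \<open>ketbra n y\<close>, and the factor \<open>r\<close> cancels the two factors
    \<open>1 / sqrt r\<close>.\<close>
  define y where "y = (\<lambda>i. of_real (1 / sqrt r) * x i)"
  have ny: "nsq n y = r" unfolding y_def nsq_scale r(2)[symmetric] using r(1) by (simp add: power2_eq_square field_simps)
  have "ketbra n y * ketbra n y = ketbra n x"
    unfolding ketbra_mult_self ny
  proof (rule eq_matI)
    fix i j assume "i < dim_row (ketbra n x)" "j < dim_col (ketbra n x)"
    then have ij: "i < n" "j < n" by auto
    have "complex_of_real r * (y i * cnj (y j)) = of_real (r * (1 / sqrt r) * (1 / sqrt r)) * (x i * cnj (x j))"
      unfolding y_def by (simp only: of_real_mult complex_cnj_mult complex_cnj_complex_of_real mult_ac)
    also have "r * (1 / sqrt r) * (1 / sqrt r) = 1" using r(1) by (simp add: field_simps)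
    finally show "(of_real r \<cdot>\<^sub>m ketbra n y) $$ (i,j) = ketbra n x $$ (i,j)"
      using ij by (simp add: ketbra_def)
  qed auto
  then have "msqrt (ketbra n x) = ketbra n y" by (rule msqrt_eqI[OF psd_ketbra])
  then show ?thesis by (simp add: tr_ketbra ny r_def)
qed

text \<open>Sandwiching a rank-one operator between copies of the root \<open>S\<close> of
  \<open>\<sigma>\<close> leaves the rank-one operator of \<open>mv S x\<close>, whose root has
  trace equal to the norm of \<open>mv S x\<close>. Only this case is required, because the second
  channel compared always has a single Kraus operator and the probe is pure.\<close>

lemma fidelity_pure:
  assumes "psd n \<sigma>"
  shows "fidelity \<sigma> (ketbra n x) = sqrt (Re (ip n x (mv \<sigma> x)))"
proof -
  define S where "S = msqrt \<sigma>"
  have S: "S \<in> carrier_mat n n" "dag S = S" "S * S = \<sigma>"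
    using msqrt_psd[OF assms] by (auto simp: S_def psd_def hermitian_def)
  have "S * ketbra n x * S = ketbra n (mv S x)"
    using ketbra_conj[OF S(1), of x] S(2) by simp
  then have "fidelity \<sigma> (ketbra n x) = sqrt (nsq n (mv S x))"
    by (simp add: fidelity_def S_def[symmetric] tr_msqrt_ketbra)
  also have "complex_of_real (nsq n (mv S x)) = ip n (mv (dag S) x) (mv S x)"
    by (simp add: ip_self S)
  then have "complex_of_real (nsq n (mv S x)) = ip n x (mv \<sigma> x)"
    unfolding ip_mv[OF S(1), symmetric] using S by (simp add: mv_mult[symmetric])
  then have "nsq n (mv S x) = Re (ip n x (mv \<sigma> x))" by (metis Re_complex_of_real)
  finally show ?thesis .
qed

section \<open>Channels on an entangled probe state\<close>

lemma sum_list_map_nth: "(\<Sum>x\<leftarrow>xs. f x) = (\<Sum>k<length xs. f (xs ! k))"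
  by (simp add: sum_list_sum_nth lessThan_atLeast0)

lemma apply_kraus_ketbra:
  assumes "\<forall>K\<in>set Ks. K \<in> carrier_mat m n"
  shows "apply_kraus m Ks (ketbra n x) = 
    mat m m (\<lambda>(a,b). \<Sum>k<length Ks. mv (Ks ! k) x a * cnj (mv (Ks ! k) x b))"
proof -
  have "(Ks ! k * ketbra n x * dag (Ks ! k)) $$ (a,b) = mv (Ks ! k) x a * cnj (mv (Ks ! k) x b)"
    if "k < length Ks" "a < m" "b < m" for k a b
    using ketbra_conj[of "Ks ! k" m n x] assms that by (simp add: ketbra_def)
  then show ?thesis
    by (auto simp: apply_kraus_def sum_list_map_nth intro!: eq_matI)
qed

lemma apply_kraus_single_ketbra:
  assumes "K \<in> carrier_mat m n"
  shows "apply_kraus m [K] (ketbra n x) = ketbra m (mv K x)"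
  using apply_kraus_ketbra[of "[K]" m n x] assms by (simp add: ketbra_def)

lemma apply_kraus_ketbra_quadratic:
  assumes "\<forall>K\<in>set Ks. K \<in> carrier_mat m n"
  shows "ip m y (mv (apply_kraus m Ks (ketbra n x)) y) = of_real (\<Sum>K\<leftarrow>Ks. (cmod (ip m y (mv K x)))\<^sup>2)"
proof -
  let ?q = "\<lambda>k. mv (Ks ! k) x"
  have "mv (apply_kraus m Ks (ketbra n x)) y i = (\<Sum>k<length Ks. ?q k i * ip m (?q k) y)" if "i < m" for i
  proof -
    have "mv (apply_kraus m Ks (ketbra n x)) y i = (\<Sum>j<m. \<Sum>k<length Ks. ?q k i * cnj (?q k j) * y j)"
      unfolding apply_kraus_ketbra[OF assms] using that by (simp add: mv_def[of "mat m m f" for f] sum_distrib_right)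
    also have "\<dots> = (\<Sum>k<length Ks. \<Sum>j<m. ?q k i * cnj (?q k j) * y j)" by (rule sum.swap)
    finally show ?thesis by (simp add: ip_def sum_distrib_left mult.assoc)
  qed
  then have "ip m y (mv (apply_kraus m Ks (ketbra n x)) y) = (\<Sum>i<m. \<Sum>k<length Ks. cnj (y i) * ?q k i * ip m (?q k) y)"
    by (simp add: ip_def[of m y] sum_distrib_left mult.assoc)
  also have "\<dots> = (\<Sum>k<length Ks. \<Sum>i<m. cnj (y i) * ?q k i * ip m (?q k) y)" by (rule sum.swap)
  also have "\<dots> = (\<Sum>k<length Ks. ip m y (?q k) * ip m (?q k) y)" by (simp add: ip_def[of m y] sum_distrib_right)
  also have "\<dots> = (\<Sum>k<length Ks. of_real ((cmod (ip m y (?q k)))\<^sup>2))"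
    by (intro sum.cong refl) (metis cnj_ip complex_norm_square)
  finally show ?thesis by (simp add: sum_list_map_nth)
qed

lemma psd_apply_kraus_ketbra:
  assumes "\<forall>K\<in>set Ks. K \<in> carrier_mat m n"
  shows "psd m (apply_kraus m Ks (ketbra n x))"
proof -
  have "hermitian m (apply_kraus m Ks (ketbra n x))"
    unfolding apply_kraus_ketbra[OF assms] hermitian_def by (auto simp: mult.commute intro!: eq_matI)
  moreover have "0 \<le> (\<Sum>K\<leftarrow>Ks. (cmod (ip m y (mv K x)))\<^sup>2)" for y
    by (rule sum_list_nonneg) auto
  ultimately show ?thesis
    unfolding psd_alt apply_kraus_ketbra_quadratic[OF assms] Re_complex_of_real by blast
qed

section \<open>Composite indices and the entangled probe state\<close>

lemma sum_lessThan_mult: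
  fixes f :: "nat \<Rightarrow> 'a::comm_monoid_add"
  shows "(\<Sum>i<m * r. f i) = (\<Sum>a<m. \<Sum>x<r. f (a * r + x))"
proof -
  have "sum f {a * r..<a * r + r} = (\<Sum>x<r. f (a * r + x))" for a
    using sum.shift_bounds_nat_ivl[of f 0 "a * r" r] by (simp add: lessThan_atLeast0 add.commute)
  then show ?thesis by (simp add: sum.nat_group[symmetric])
qed

text \<open>The vector \<open>(w\<^sub>0 \<otimes> e\<^sub>0 + w\<^sub>1 \<otimes> e\<^sub>1) / \<surd>2\<close>. Since the reference vectors are orthogonal, it is
  normalised as soon as \<open>w\<^sub>0\<close> and \<open>w\<^sub>1\<close> are, and cross terms never appear.\<close>

definition ent :: "nat \<Rightarrow> (nat \<Rightarrow> nat \<Rightarrow> complex) \<Rightarrow> nat \<Rightarrow> complex" where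
  "ent r w i = (if i mod r < 2 then w (i mod r) (i div r) / of_real (sqrt 2) else 0)"

text \<open>The reference label \<open>i mod r\<close> is untouched by \<open>kron_id r K\<close>,
  so the image of a probe vector is again of the form \<open>ent\<close>, with \<open>K\<close>
  applied to each component.\<close>

lemma mv_kron_id_ent:
  assumes "r > 0" "i < dim_row K * r"
  shows "mv (kron_id r K) (ent r w) i = ent r (\<lambda>b. mv K (w b)) i"
proof -
  have i: "i div r < dim_row K" using assms by (simp add: less_mult_imp_div_less)
  have "mv (kron_id r K) (ent r w) i = 
     (\<Sum>j<dim_col K * r. (if i mod r = j mod r then K $$ (i div r, j div r) else 0) * ent r w j)"
    using assms by (simp add: mv_def kron_id_def)
  also have "\<dots> = (\<Sum>a<dim_col K. \<Sum>x<r. (if i mod r = x then K $$ (i div r, a) else 0) * ent r w (a * r + x))"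
    unfolding sum_lessThan_mult using assms by (intro sum.cong refl) auto
  also have "\<dots> = (\<Sum>a<dim_col K. K $$ (i div r, a) * ent r w (a * r + i mod r))"
    using assms by (intro sum.cong refl, subst sum_lessThan_single[of "i mod r"]) auto
  also have "\<dots> = ent r (\<lambda>b. mv K (w b)) i"
    using assms i by (auto simp: ent_def mv_def sum_divide_distrib)
  finally show ?thesis .
qed

lemma ip_ent:
  assumes "r \<ge> 2"
  shows "ip (m * r) (ent r w) (ent r w') = (\<Sum>b<2. ip m (w b) (w' b)) / 2"
proof -
  have s2: "complex_of_real (sqrt 2) * complex_of_real (sqrt 2) = 2"
    by (simp flip: of_real_mult)
  have "ip (m * r) (ent r w) (ent r w') = (\<Sum>a<m. \<Sum>x<r. if x < 2 then cnj (w x a) * w' x a / 2 else 0)"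
    unfolding ip_def sum_lessThan_mult by (intro sum.cong refl) (use assms in \<open>auto simp: ent_def s2\<close>)
  also have "\<dots> = (\<Sum>a<m. \<Sum>x<2. cnj (w x a) * w' x a / 2)"
  proof (rule sum.cong[OF refl])
    fix a
    have "(\<Sum>x<r. if x < 2 then cnj (w x a) * w' x a / 2 else 0) = (\<Sum>x<2. if x < 2 then cnj (w x a) * w' x a / 2 else 0)"
      by (rule sum.mono_neutral_right) (use assms in auto)
    then show "(\<Sum>x<r. if x < 2 then cnj (w x a) * w' x a / 2 else 0) = (\<Sum>x<2. cnj (w x a) * w' x a / 2)"
      by simp
  qed
  also have "\<dots> = (\<Sum>x<2. \<Sum>a<m. cnj (w x a) * w' x a / 2)" by (rule sum.swap)
  finally show ?thesis by (simp add: ip_def sum_divide_distrib)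
qed

lemma kron_id_carrier: "K \<in> carrier_mat m n \<Longrightarrow> kron_id r K \<in> carrier_mat (m * r) (n * r)"
  by (auto simp: kron_id_def)

text \<open>The output of the second channel is pure, so the squared fidelity is the sum over the
  Kraus operators of the first channel of squared overlaps. Orthogonality of the reference vectors
  turns each overlap into the mean of the two component overlaps.\<close>

lemma purified_dist_ent:
  assumes r: "r \<ge> 2" and Ks: "\<forall>K\<in>set Ks. K \<in> carrier_mat m n" and K2: "K2 \<in> carrier_mat m n"
  shows "purified_dist (apply_kraus (m * r) (map (kron_id r) Ks) (ketbra (n * r) (ent r w)))
      (apply_kraus (m * r) (map (kron_id r) [K2]) (ketbra (n * r) (ent r w)))
    = sqrt (1 - (\<Sum>K\<leftarrow>Ks. (cmod ((\<Sum>b<2. ip m (mv K2 (w b)) (mv K (w b))) / 2))\<^sup>2))"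
proof -
  have Ks': "\<forall>K\<in>set (map (kron_id r) Ks). K \<in> carrier_mat (m * r) (n * r)"
    using Ks kron_id_carrier by auto
  let ?x = "ent r w" and ?y = "mv (kron_id r K2) (ent r w)"
  have ip: "ip (m * r) ?y (mv (kron_id r K) ?x) = (\<Sum>b<2. ip m (mv K2 (w b)) (mv K (w b))) / 2"
    if "K \<in> set Ks" for K
  proof -
    have "ip (m * r) ?y (mv (kron_id r K) ?x) = ip (m * r) (ent r (\<lambda>b. mv K2 (w b))) (ent r (\<lambda>b. mv K (w b)))"
      using r K2 Ks that by (intro ip_cong mv_kron_id_ent) auto
    then show ?thesis by (simp add: ip_ent[OF r])
  qed
  have nn: "0 \<le> (\<Sum>K\<leftarrow>Ks. (cmod ((\<Sum>b<2. ip m (mv K2 (w b)) (mv K (w b))) / 2))\<^sup>2)"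
    by (rule sum_list_nonneg) auto
  have "fidelity (apply_kraus (m * r) (map (kron_id r) Ks) (ketbra (n * r) ?x)) (ketbra (m * r) ?y)
    = sqrt (\<Sum>K\<leftarrow>map (kron_id r) Ks. (cmod (ip (m * r) ?y (mv K ?x)))\<^sup>2)"
    unfolding fidelity_pure[OF psd_apply_kraus_ketbra[OF Ks']] apply_kraus_ketbra_quadratic[OF Ks'] Re_complex_of_real ..
  also have "(\<Sum>K\<leftarrow>map (kron_id r) Ks. (cmod (ip (m * r) ?y (mv K ?x)))\<^sup>2) 
    = (\<Sum>K\<leftarrow>Ks. (cmod ((\<Sum>b<2. ip m (mv K2 (w b)) (mv K (w b))) / 2))\<^sup>2)"
    using ip by (simp add: o_def del: times_divide_eq_right eq_divide_eq_numeral1 cong: map_cong)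
  finally show ?thesis
    using nn kron_id_carrier[OF K2, of r] by (simp add: purified_dist_def apply_kraus_single_ketbra)
qed

lemma density_ent:
  fixes w :: "nat \<Rightarrow> nat \<Rightarrow> complex"
  assumes "n \<ge> 2" "\<And>b. b < 2 \<Longrightarrow> nsq n (w b) = 1"
  shows "density (n * n) (ketbra (n * n) (ent n w))"
proof -
  have "complex_of_real (nsq (n * n) (ent n w)) = (\<Sum>b<2. of_real (nsq n (w b))) / 2"
    using ip_ent[OF assms(1), of n w w] by (simp only: ip_self)
  also have "\<dots> = 1" using assms(2) by simp
  finally show ?thesis by (simp add: density_def psd_ketbra tr_ketbra)
qed

lemma purified_dist_le_1: "purified_dist \<rho> \<sigma> \<le> 1"
  by (simp add: purified_dist_def)

text \<open>The probe is one of the states in the supremum, which is bounded above by 1 and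
  therefore a genuine upper bound.\<close>

lemma chan_pdist_ge:
  fixes w :: "nat \<Rightarrow> nat \<Rightarrow> complex"
  assumes "n \<ge> 2" "\<And>b. b < 2 \<Longrightarrow> nsq n (w b) = 1"
    and "\<forall>K\<in>set Ks. K \<in> carrier_mat m n" "K2 \<in> carrier_mat m n"
  shows "sqrt (1 - (\<Sum>K\<leftarrow>Ks. (cmod ((\<Sum>b<2. ip m (mv K2 (w b)) (mv K (w b))) / 2))\<^sup>2)) \<le> chan_pdist n m Ks [K2]"
  unfolding chan_pdist_def purified_dist_ent[OF assms(1,3,4), symmetric]
  by (rule cSup_upper)
     (use density_ent[of n w] assms(1,2) purified_dist_le_1 in \<open>auto intro!: bdd_aboveI[of _ 1]\<close>)

lemma density_exists:
  assumes "n > 0"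
  shows "\<exists>\<rho>. density n \<rho>"
proof
  have "nsq n (\<lambda>i. if i = 0 then 1 else 0) = 1"
    unfolding nsq_def using assms by (subst sum_lessThan_single[of 0]) auto
  then show "density n (ketbra n (\<lambda>i. if i = 0 then 1 else 0))"
    by (simp add: density_def psd_ketbra tr_ketbra)
qed

text \<open>Existence of a state matters here, since a supremum is bounded by its elements only over
  a nonempty set. The result bounds the set whose supremum over \<open>\<theta>\<close> is
  \<open>cov_viol\<close>.\<close>

lemma chan_pdist_le_1:
  assumes "n > 0"
  shows "chan_pdist n m Ks Ks' \<le> 1"
  unfolding chan_pdist_def
  by (rule cSup_least) (use density_exists[of "n * n"] assms purified_dist_le_1 in auto)

section \<open>Exponentials and eigenvalues\<close>

lemma conj_diagm_power:
  assumes "unitary n U"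
  shows "(U * diagm n d * dag U) ^\<^sub>m k = U * diagm n (\<lambda>i. d i ^ k) * dag U"
proof (induction k)
  case 0
  have "diagm n (\<lambda>i. 1) = 1\<^sub>m n" by (rule eq_matI) (auto simp: diagm_def)
  then show ?case using assms by (auto simp: unitary_def)
next
  case (Suc k)
  have U: "U \<in> carrier_mat n n" "dag U * U = 1\<^sub>m n" using assms by (auto simp: unitary_def)
  have "(U * diagm n d * dag U) ^\<^sub>m Suc k = U * (diagm n (\<lambda>i. d i ^ k) * diagm n d) * dag U"
    unfolding pow_mat.simps Suc.IH using U by (simp add: mult_assoc_dim mult_left_cancel[OF U(2)])
  then show ?case by (simp add: diagm_mult mult.commute)
qed

lemma smult_diagm: "c \<cdot>\<^sub>m diagm n d = diagm n (\<lambda>i. c * d i)"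
  by (rule eq_matI) (auto simp: diagm_def)

text \<open>Each entry of the power series is a finite combination, over the eigenvalues, of scalar
  exponential series, so the entrywise infinite sum in \<open>mexp\<close> converges to the expected
  value.\<close>

lemma mexp_conj_diagm:
  assumes "unitary n U"
  shows "mexp (U * diagm n d * dag U) = U * diagm n (\<lambda>i. exp (d i)) * dag U"
proof -
  have U: "U \<in> carrier_mat n n" using assms by (auto simp: unitary_def)
  have *: "(\<lambda>k. (U * diagm n (\<lambda>i. d i ^ k) * dag U) $$ (i,j) / of_nat (fact k)) sums 
     ((U * diagm n (\<lambda>i. exp (d i)) * dag U) $$ (i,j))" if "i < n" "j < n" for i j
  proof -
    have "(\<lambda>k. \<Sum>l<n. U $$ (i,l) * (d l ^ k /\<^sub>R fact k) * cnj (U $$ (j,l))) sums 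
       (\<Sum>l<n. U $$ (i,l) * exp (d l) * cnj (U $$ (j,l)))"
      by (intro sums_sum sums_mult sums_mult2 exp_converges)
    then show ?thesis
      unfolding index_conj_diagm[OF U that]
      by (simp add: sum_divide_distrib scaleR_conv_of_real field_simps)
  qed
  show ?thesis
    unfolding mexp_def using U
    by (intro eq_matI) (auto simp: conj_diagm_power[OF assms] sums_unique[OF *, symmetric]
        simp del: index_mult_mat(1) of_nat_fact)
qed

lemma U1_conj_diagm:
  assumes "unitary n U"
  shows "U1 (U * diagm n d * dag U) \<theta> = U * diagm n (\<lambda>i. exp (- \<i> * of_real \<theta> * d i)) * dag U"
proof -
  have U: "U \<in> carrier_mat n n" using assms by (auto simp: unitary_def)
  have "c \<cdot>\<^sub>m (U * diagm n d * dag U) = U * diagm n (\<lambda>i. c * d i) * dag U" for c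
    using U by (simp add: smult_diagm[symmetric] mult_smult_assoc_mat[of _ n n _ n] mult_smult_distrib[of _ n n _ n])
  then show ?thesis
    unfolding U1_def using mexp_conj_diagm[OF assms, of "\<lambda>i. - \<i> * of_real \<theta> * d i"] by simp
qed

text \<open>In the coordinates \<open>mv (dag U) x\<close> the matrix multiplies entry
  \<open>k\<close> by \<open>d k\<close>. An eigenvector has some nonzero coordinate because
  \<open>U\<close> is invertible, which forces \<open>l = d k\<close>; conversely column
  \<open>k\<close> of \<open>U\<close> is an eigenvector.\<close>

lemma eigenvalue_conj_diagm:
  assumes "unitary n U"
  shows "eigenvalue (U * diagm n d * dag U) l \<longleftrightarrow> (\<exists>k<n. l = d k)"
proof -
  let ?A = "U * diagm n d * dag U"
  have U: "U \<in> carrier_mat n n" "dag U * U = 1\<^sub>m n" "U * dag U = 1\<^sub>m n" using assms by (auto simp: unitary_def)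
  have A: "dim_row ?A = n" "dim_col ?A = n" using U by auto
  have ev: "?A *\<^sub>v v = l \<cdot>\<^sub>v v \<longleftrightarrow> (\<forall>i<n. mv ?A (vec_index v) i = l * vec_index v i)" if v: "v \<in> carrier_vec n" for v
  proof -
    have "vec_index (?A *\<^sub>v v) i = mv ?A (vec_index v) i" if "i < n" for i
      using that v A by (simp add: mv_def scalar_prod_def lessThan_atLeast0 del: index_mult_mat)
    then show ?thesis using v A by (auto simp: vec_eq_iff simp del: index_mult_mat_vec index_mult_mat)
  qed
  have UA: "mv (dag U) (mv ?A x) k = d k * mv (dag U) x k" if "k < n" for x k
  proof -
    have "mv (dag U) (mv ?A x) = mv (dag U * ?A) x" using U by (simp add: mv_mult)
    also have "dag U * ?A = diagm n d * dag U" using U by (simp add: mult_assoc_dim mult_left_cancel[OF U(2)])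
    finally show ?thesis using U that by (simp add: mv_mult mv_diagm)
  qed
  show ?thesis
  proof
    assume "eigenvalue ?A l"
    then obtain v where v: "v \<in> carrier_vec n" "v \<noteq> 0\<^sub>v n" "?A *\<^sub>v v = l \<cdot>\<^sub>v v"
      using A by (auto simp: eigenvalue_def eigenvector_def)
    define x where "x = vec_index v"
    have x: "\<forall>i<n. mv ?A x i = l * x i" using v(3) unfolding ev[OF v(1)] x_def .
    obtain i where i: "i < n" "x i \<noteq> 0" using v(1,2) by (auto simp: vec_eq_iff x_def)
    have "mv U (mv (dag U) x) = mv (1\<^sub>m n) x" using U by (simp add: mv_mult[symmetric])
    then have "mv U (mv (dag U) x) i = x i" using i by (simp add: mv_one)
    then have "\<exists>k<n. mv (dag U) x k \<noteq> 0"
      using i U by (auto simp: mv_def[of U] intro: ccontr)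
    then obtain k where k: "k < n" "mv (dag U) x k \<noteq> 0" by blast
    have "mv (dag U) (mv ?A x) = mv (dag U) (\<lambda>i. l * x i)"
      using x U by (intro mv_cong) auto
    then have "d k * mv (dag U) x k = l * mv (dag U) x k"
      using UA[OF k(1), of x] k(1) U by (simp add: mv_def[of "dag U"] sum_distrib_left mult_ac)
    then show "\<exists>k<n. l = d k" using k by auto
  next
    assume "\<exists>k<n. l = d k"
    then obtain k where k: "k < n" "l = d k" by blast
    define e :: "nat \<Rightarrow> complex" where "e = (\<lambda>i. if i = k then 1 else 0)"
    define v where "v = vec n (mv U e)"
    have v: "v \<in> carrier_vec n" by (simp add: v_def)
    have UU: "mv (dag U) (mv U e) i = e i" if "i < n" for i
    proof -
      have "mv (dag U) (mv U e) = mv (1\<^sub>m n) e" using U by (simp add: mv_mult[symmetric])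
      then show ?thesis using that by (simp add: mv_one)
    qed
    have "v \<noteq> 0\<^sub>v n"
    proof
      assume "v = 0\<^sub>v n"
      then have "mv U e i = 0" if "i < n" for i using that by (auto simp: v_def vec_eq_iff)
      then have "mv (dag U) (mv U e) k = 0" using U k by (simp add: mv_def[of "dag U"])
      then show False using UU[OF k(1)] by (simp add: e_def)
    qed
    moreover have "?A *\<^sub>v v = l \<cdot>\<^sub>v v"
      unfolding ev[OF v]
    proof (intro allI impI)
      fix i assume i: "i < n"
      have "mv ?A (vec_index v) = mv ?A (mv U e)" using A by (intro mv_cong) (auto simp: v_def)
      also have "\<dots> = mv U (mv (diagm n d) (mv (dag U) (mv U e)))" using U by (simp add: mv_mult)
      also have "\<dots> = mv U (\<lambda>i. l * e i)" 
        using U UU k by (intro mv_cong) (auto simp: mv_diagm e_def)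
      finally show "mv ?A (vec_index v) i = l * vec_index v i"
        using i U by (simp add: v_def mv_def[of U] sum_distrib_left mult_ac)
    qed
    ultimately show "eigenvalue ?A l"
      using v A unfolding eigenvalue_def eigenvector_def by auto
  qed
qed

lemma spread_conj_diagm:
  assumes "unitary n U"
  shows "spread (U * diagm n (\<lambda>i. of_real (d i)) * dag U) = Max (d ` {..<n}) - Min (d ` {..<n})"
proof -
  have "Re ` {l. eigenvalue (U * diagm n (\<lambda>i. of_real (d i)) * dag U) l} = d ` {..<n}"
    unfolding eigenvalue_conj_diagm[OF assms] by force
  then show ?thesis by (simp add: spread_def)
qed

section \<open>Almost periodic sums\<close>

text \<open>For \<open>z\<close> different from 1 the geometric sums stay below
  \<open>2 / norm (1 - z)\<close>, so dividing by \<open>N\<close> sends them to 0.\<close>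

lemma mean_geometric_tendsto:
  fixes z :: complex
  assumes "norm z = 1"
  shows "(\<lambda>N. (\<Sum>n<N. z ^ n) / of_nat N) \<longlonglongrightarrow> (if z = 1 then 1 else 0)"
proof (cases "z = 1")
  case True
  have "eventually (\<lambda>N. (\<Sum>n<N. z ^ n) / of_nat N = 1) sequentially"
    using eventually_gt_at_top[of 0] by eventually_elim (simp add: True)
  then show ?thesis using True by (simp add: tendsto_eventually)
next
  case False
  have "norm ((\<Sum>n<N. z ^ n) / of_nat N) \<le> (2 / norm (1 - z)) * (1 / of_nat N)" for N
  proof -
    have "norm (1 - z ^ N) \<le> norm (1::complex) + norm (z ^ N)" by (rule norm_triangle_ineq4)
    then have "norm (1 - z ^ N) \<le> 2" using assms by (simp add: norm_power)
    then have "norm (1 - z ^ N) / (norm (1 - z) * real N) \<le> 2 / (norm (1 - z) * real N)"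
      by (intro divide_right_mono) auto
    then show ?thesis
      using False by (simp add: sum_gp_strict norm_divide norm_mult)
  qed
  moreover have "(\<lambda>N. (2 / norm (1 - z)) * (1 / of_nat N)) \<longlonglongrightarrow> (2 / norm (1 - z)) * 0"
    by (intro tendsto_mult_left lim_1_over_n)
  ultimately have "(\<lambda>N. (\<Sum>n<N. z ^ n) / of_nat N) \<longlonglongrightarrow> 0"
    unfolding mult_zero_right by (rule Lim_null_comparison[OF always_eventually[OF allI]])
  then show ?thesis using False by simp
qed

text \<open>Sampling \<theta> at the multiples of a step that is too small for distinct frequencies to alias,
  the Cesaro mean of the squared modulus keeps exactly the resonant pairs.\<close>

lemma trig_sum_square_lower_bound:
  fixes c \<omega> :: "'j \<Rightarrow> real"
  assumes J: "finite J" and B: "\<And>\<theta>. B \<le> (cmod (\<Sum>j\<in>J. of_real (c j) * exp (- \<i> * of_real \<theta> * of_real (\<omega> j))))\<^sup>2"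
  shows "B \<le> (\<Sum>j\<in>J. c j * (\<Sum>k\<in>{k\<in>J. \<omega> k = \<omega> j}. c k))"
proof -
  define M where "M = (\<Sum>j\<in>J. \<bar>\<omega> j\<bar>)"
  \<comment> \<open>Frequency differences are at most \<open>2 * M\<close> in modulus, so
    \<open>\<tau>\<close> times a difference is below 1, hence below \<open>2 * pi\<close>; a phase
    equal to 1 then means equal frequencies.\<close>
  define \<tau> where "\<tau> = 1 / (1 + 2 * M)"
  have M: "\<bar>\<omega> j\<bar> \<le> M" if "j \<in> J" for j
    unfolding M_def using J that by (intro member_le_sum) auto
  have M0: "M \<ge> 0" unfolding M_def by (rule sum_nonneg) auto
  define z where "z j k = exp (\<i> * of_real (\<tau> * (\<omega> k - \<omega> j)))" for j k
  have z1: "z j k = 1 \<longleftrightarrow> \<omega> k = \<omega> j" if "j \<in> J" "k \<in> J" for j k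
  proof
    assume "z j k = 1"
    then obtain n :: int where n: "\<tau> * (\<omega> k - \<omega> j) = of_int (2 * n) * pi"
      unfolding z_def exp_eq_1 by auto
    have "\<bar>\<omega> k - \<omega> j\<bar> < 1 + 2 * M" using M[OF that(1)] M[OF that(2)] by linarith
    then have "\<bar>\<tau> * (\<omega> k - \<omega> j)\<bar> < 1" using M0 by (simp add: \<tau>_def abs_mult)
    then have small: "\<bar>of_int (2 * n) * pi\<bar> < 1" using n by simp
    have "n = 0"
    proof (rule ccontr)
      assume "n \<noteq> 0"
      then have "1 \<le> \<bar>real_of_int (2 * n)\<bar>" by linarith
      then have "1 * 1 \<le> \<bar>real_of_int (2 * n)\<bar> * pi" using pi_gt3 by (intro mult_mono) auto
      then show False using small by (simp add: abs_mult)
    qed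
    then show "\<omega> k = \<omega> j" using n M0 by (simp add: \<tau>_def)
  qed (simp add: z_def)
  define f where "f \<theta> = (\<Sum>j\<in>J. complex_of_real (c j) * exp (- \<i> * of_real \<theta> * of_real (\<omega> j)))" for \<theta> :: real
  have sq: "of_real ((cmod (f (real n * \<tau>)))\<^sup>2) = (\<Sum>j\<in>J. \<Sum>k\<in>J. of_real (c j * c k) * z j k ^ n)" for n
  proof -
    have "of_real ((cmod (f (real n * \<tau>)))\<^sup>2) = f (real n * \<tau>) * cnj (f (real n * \<tau>))"
      by (rule complex_norm_square)
    also have "\<dots> = (\<Sum>j\<in>J. \<Sum>k\<in>J. (of_real (c j) * exp (- \<i> * of_real (real n * \<tau>) * of_real (\<omega> j))) 
       * (of_real (c k) * exp (\<i> * of_real (real n * \<tau>) * of_real (\<omega> k))))"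
      unfolding f_def by (simp add: sum_product exp_cnj)
    also have "\<dots> = (\<Sum>j\<in>J. \<Sum>k\<in>J. of_real (c j * c k) * z j k ^ n)"
    proof (intro sum.cong refl)
      fix j k
      have "exp (- \<i> * of_real (real n * \<tau>) * of_real (\<omega> j)) * exp (\<i> * of_real (real n * \<tau>) * of_real (\<omega> k)) = z j k ^ n"
        unfolding z_def by (simp add: exp_of_nat_mult[symmetric] mult_exp_exp algebra_simps)
      then show "(of_real (c j) * exp (- \<i> * of_real (real n * \<tau>) * of_real (\<omega> j))) 
       * (of_real (c k) * exp (\<i> * of_real (real n * \<tau>) * of_real (\<omega> k))) = of_real (c j * c k) * z j k ^ n"
        by (simp only: of_real_mult mult_ac)
    qed
    finally show ?thesis .
  qed
  define S where "S = (\<Sum>j\<in>J. \<Sum>k\<in>J. c j * c k * (if \<omega> k = \<omega> j then 1 else 0))"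
  have "(\<lambda>N. \<Sum>j\<in>J. \<Sum>k\<in>J. complex_of_real (c j * c k) * ((\<Sum>n<N. z j k ^ n) / of_nat N)) 
     \<longlonglongrightarrow> (\<Sum>j\<in>J. \<Sum>k\<in>J. of_real (c j * c k) * (if z j k = 1 then 1 else 0))"
    by (intro tendsto_sum tendsto_mult_left mean_geometric_tendsto) (simp add: z_def)
  also have "(\<lambda>N. \<Sum>j\<in>J. \<Sum>k\<in>J. complex_of_real (c j * c k) * ((\<Sum>n<N. z j k ^ n) / of_nat N)) 
    = (\<lambda>N. of_real ((\<Sum>n<N. (cmod (f (real n * \<tau>)))\<^sup>2) / real N))"
  proof
    fix N
    have "of_real ((\<Sum>n<N. (cmod (f (real n * \<tau>)))\<^sup>2) / real N) 
       = (\<Sum>n<N. \<Sum>j\<in>J. \<Sum>k\<in>J. complex_of_real (c j * c k) * z j k ^ n) / of_nat N"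
      unfolding sq[symmetric] by simp
    also have "(\<Sum>n<N. \<Sum>j\<in>J. \<Sum>k\<in>J. complex_of_real (c j * c k) * z j k ^ n) 
       = (\<Sum>j\<in>J. \<Sum>n<N. \<Sum>k\<in>J. complex_of_real (c j * c k) * z j k ^ n)" by (rule sum.swap)
    also have "\<dots> = (\<Sum>j\<in>J. \<Sum>k\<in>J. \<Sum>n<N. complex_of_real (c j * c k) * z j k ^ n)"
      by (rule sum.cong[OF refl]) (rule sum.swap)
    finally show "(\<Sum>j\<in>J. \<Sum>k\<in>J. complex_of_real (c j * c k) * ((\<Sum>n<N. z j k ^ n) / of_nat N))
      = of_real ((\<Sum>n<N. (cmod (f (real n * \<tau>)))\<^sup>2) / real N)"
      by (simp add: sum_distrib_left sum_divide_distrib)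
  qed
  also have "(\<Sum>j\<in>J. \<Sum>k\<in>J. complex_of_real (c j * c k) * (if z j k = 1 then 1 else 0)) = of_real S"
    unfolding S_def of_real_sum by (intro sum.cong refl) (auto simp: z1)
  finally have lim: "(\<lambda>N. (\<Sum>n<N. (cmod (f (real n * \<tau>)))\<^sup>2) / real N) \<longlonglongrightarrow> S"
    by (simp only: tendsto_of_real_iff)
  have "B \<le> S"
  \<comment> \<open>The averages are bounded below from \<open>N = 1\<close> on; at
    \<open>N = 0\<close> the quotient takes the default value 0.\<close>
  proof (rule LIMSEQ_le_const[OF lim], intro exI[of _ 1] allI impI)
    fix N :: nat assume N: "N \<ge> 1"
    have "(\<Sum>n<N. B) \<le> (\<Sum>n<N. (cmod (f (real n * \<tau>)))\<^sup>2)"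
      using B unfolding f_def by (intro sum_mono)
    then show "B \<le> (\<Sum>n<N. (cmod (f (real n * \<tau>)))\<^sup>2) / real N"
      using N by (simp add: field_simps)
  qed
  also have "S = (\<Sum>j\<in>J. c j * (\<Sum>k\<in>{k\<in>J. \<omega> k = \<omega> j}. c k))"
    unfolding S_def using J
    by (intro sum.cong refl) (simp add: sum_distrib_left sum.inter_filter, intro sum.cong refl, auto)
  finally show ?thesis .
qed

text \<open>Take the heaviest atom, of mass \<open>m\<close>. Every atom has mass at most
  \<open>m\<close>, giving the first bound; every other atom has mass at most \<open>1 - m\<close>,
  giving the second. The second is symmetric under exchanging \<open>m\<close> and
  \<open>1 - m\<close>, and the first serves to exclude small \<open>m\<close>.\<close>

lemma collision_probability_concentrates:
  fixes c \<omega> :: "'j \<Rightarrow> real"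
  assumes J: "finite J" and c: "\<And>j. j \<in> J \<Longrightarrow> c j \<ge> 0" and c1: "(\<Sum>j\<in>J. c j) = 1"
    and B: "B \<le> (\<Sum>j\<in>J. c j * (\<Sum>k\<in>{k\<in>J. \<omega> k = \<omega> j}. c k))"
  obtains x m where "m = (\<Sum>j\<in>{j\<in>J. \<omega> j = x}. c j)" "B \<le> m" "B \<le> m\<^sup>2 + (1 - m)\<^sup>2"
proof -
  define M where "M x = (\<Sum>j\<in>{j\<in>J. \<omega> j = x}. c j)" for x
  have ne: "J \<noteq> {}" using c1 by auto
  have "Max ((\<lambda>j. M (\<omega> j)) ` J) \<in> (\<lambda>j. M (\<omega> j)) ` J" using J ne by (intro Max_in) auto
  then obtain j0 where j0: "j0 \<in> J" "Max ((\<lambda>j. M (\<omega> j)) ` J) = M (\<omega> j0)" by auto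
  define x where "x = \<omega> j0"
  have mx: "M (\<omega> j) \<le> M x" if "j \<in> J" for j
    unfolding x_def j0(2)[symmetric] using J that by (intro Max_ge) auto
  have B': "B \<le> (\<Sum>j\<in>J. c j * M (\<omega> j))" using B by (simp add: M_def)
  have "(\<Sum>j\<in>J. c j * M (\<omega> j)) \<le> (\<Sum>j\<in>J. c j * M x)"
    by (intro sum_mono mult_left_mono mx c)
  also have "\<dots> = M x" by (simp add: sum_distrib_right[symmetric] c1)
  finally have 1: "B \<le> M x" using B' by simp
  have split: "(\<Sum>j\<in>J. g j) = (\<Sum>j\<in>{j\<in>J. \<omega> j = y}. g j) + (\<Sum>j\<in>{j\<in>J. \<omega> j \<noteq> y}. g j)" for y and g :: "'j \<Rightarrow> real"
    using J by (subst sum.union_disjoint[symmetric]) (auto intro!: sum.cong)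
  have rest: "(\<Sum>j\<in>{j\<in>J. \<omega> j \<noteq> x}. c j) = 1 - M x" using split[of c x] c1 by (simp add: M_def)
  have other: "M (\<omega> j) \<le> 1 - M x" if "\<omega> j \<noteq> x" for j
    unfolding rest[symmetric] unfolding M_def using J c that by (intro sum_mono2) auto
  have "(\<Sum>j\<in>J. c j * M (\<omega> j)) = (\<Sum>j\<in>{j\<in>J. \<omega> j = x}. c j * M (\<omega> j)) + (\<Sum>j\<in>{j\<in>J. \<omega> j \<noteq> x}. c j * M (\<omega> j))"
    by (rule split)
  also have "\<dots> \<le> (\<Sum>j\<in>{j\<in>J. \<omega> j = x}. c j * M x) + (\<Sum>j\<in>{j\<in>J. \<omega> j \<noteq> x}. c j * (1 - M x))"
    using c other by (intro add_mono sum_mono mult_left_mono) auto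
  also have "\<dots> = (M x)\<^sup>2 + (1 - M x)\<^sup>2"
    unfolding sum_distrib_right[symmetric] rest by (simp add: M_def power2_eq_square)
  finally have 2: "B \<le> (M x)\<^sup>2 + (1 - M x)\<^sup>2" using B' by simp
  show ?thesis using that[OF M_def 1 2] .
qed

text \<open>When \<open>\<delta>\<close> is small, most of the mixture sits on one atom, so both
  shifted distributions are concentrated at the same point and their means are close. The hypothesis
  \<open>D\<close> on the gap of the means then limits how small \<open>\<delta>\<close> can
  be.\<close>

lemma mean_shift_bound:
  fixes p :: "nat \<Rightarrow> nat \<Rightarrow> real" and E l :: "nat \<Rightarrow> real"
  assumes p: "\<And>b k. b < 2 \<Longrightarrow> k < n \<Longrightarrow> p b k \<ge> 0" and p1: "\<And>b. b < 2 \<Longrightarrow> (\<Sum>k<n. p b k) = 1"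
    and E: "\<And>k. k < n \<Longrightarrow> Emin \<le> E k \<and> E k \<le> Emax" and S: "Emin < Emax"
    and \<delta>: "\<delta> \<ge> 0" 
    and fid: "\<And>\<theta>. 1 - \<delta>\<^sup>2 \<le> (cmod ((\<Sum>b<2. \<Sum>k<n. of_real (p b k) * exp (- \<i> * of_real \<theta> * of_real (E k - l b))) / 2))\<^sup>2"
    and D: "D \<le> (\<Sum>k<n. p 1 k * (E k - l 1)) - (\<Sum>k<n. p 0 k * (E k - l 0))"
    and y: "y = sqrt (D / (Emax - Emin))"
  shows "y - y\<^sup>2 \<le> \<delta>"
\<comment> \<open>Two immediate cases: \<open>y - y\<^sup>2\<close> never exceeds 1/4, and for
  negative \<open>D\<close> the real \<open>sqrt\<close> is nonpositive, so
  \<open>y - y\<^sup>2\<close> is nonpositive as well.\<close>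
proof (cases "\<delta> \<ge> 1/4 \<or> D < 0")
  case True
  then show ?thesis
  proof
    assume "\<delta> \<ge> 1/4"
    moreover have "y - y\<^sup>2 \<le> 1/4" using zero_le_power2[of "y - 1/2"] by (simp add: power2_eq_square algebra_simps)
    ultimately show ?thesis by simp
  next
    assume "D < 0"
    then have "y \<le> 0" using S unfolding y by (simp add: divide_nonpos_pos)
    then show ?thesis using \<delta> zero_le_power2[of y] by linarith
  qed
next
  case False
  then have d4: "\<delta> < 1/4" and D0: "D \<ge> 0" by auto
  define J where "J = {..<2::nat} \<times> {..<n}"
  define c where "c = (\<lambda>(b,k). p b k / 2)"
  define \<omega> where "\<omega> = (\<lambda>(b,k). E k - l b)"
  have J: "finite J" by (simp add: J_def)
  have c0: "c j \<ge> 0" if "j \<in> J" for j using that p by (auto simp: J_def c_def)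
  have two: "{..<2::nat} = {0,1}" by auto
  have c1: "(\<Sum>j\<in>J. c j) = 1"
    unfolding J_def c_def by (simp add: sum.cartesian_product[symmetric] sum_divide_distrib[symmetric] p1)
  have "1 - \<delta>\<^sup>2 \<le> (cmod (\<Sum>j\<in>J. of_real (c j) * exp (- \<i> * of_real \<theta> * of_real (\<omega> j))))\<^sup>2" for \<theta>
  proof -
    have "(\<Sum>j\<in>J. of_real (c j) * exp (- \<i> * of_real \<theta> * of_real (\<omega> j))) = 
      (\<Sum>b<2. \<Sum>k<n. of_real (p b k) * exp (- \<i> * of_real \<theta> * of_real (E k - l b))) / 2"
      unfolding J_def c_def \<omega>_def sum.cartesian_product by (simp add: sum_divide_distrib case_prod_unfold)
    then show ?thesis using fid[of \<theta>] by (simp only:)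
  qed
  from trig_sum_square_lower_bound[OF J this]
  have "1 - \<delta>\<^sup>2 \<le> (\<Sum>j\<in>J. c j * (\<Sum>k\<in>{k\<in>J. \<omega> k = \<omega> j}. c k))" .
  from collision_probability_concentrates[OF J c0 c1 this]
  obtain x m where m: "m = (\<Sum>j\<in>{j\<in>J. \<omega> j = x}. c j)" and B1: "1 - \<delta>\<^sup>2 \<le> m" and B2: "1 - \<delta>\<^sup>2 \<le> m\<^sup>2 + (1 - m)\<^sup>2"
    by blast
  \<comment> \<open>\<open>q b\<close> is the mass that the distribution \<open>b\<close> alone
    gives to the common atom; \<open>m\<close> is the mean of \<open>q 0\<close> and
    \<open>q 1\<close>.\<close>
  define q where "q b = (\<Sum>k\<in>{k. k < n \<and> E k - l b = x}. p b k)" for b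
  have q1: "q b + (\<Sum>k\<in>{k. k < n \<and> E k - l b \<noteq> x}. p b k) = 1" if "b < 2" for b
    unfolding q_def p1[OF that, symmetric] by (subst sum.union_disjoint[symmetric]) (auto intro!: sum.cong)
  have qle: "q b \<le> 1" if "b < 2" for b
    using q1[OF that] sum_nonneg[of "{k. k < n \<and> E k - l b \<noteq> x}" "p b"] p[OF that] by auto
  have mq: "m = (q 0 + q 1) / 2"
  proof -
    have "{j\<in>J. \<omega> j = x} = (SIGMA b:{..<2}. {k. k < n \<and> E k - l b = x})" by (auto simp: J_def \<omega>_def)
    then have "m = (\<Sum>b<2. \<Sum>k\<in>{k. k < n \<and> E k - l b = x}. p b k / 2)"
      unfolding m c_def by (simp add: sum.Sigma)
    then show ?thesis by (simp add: q_def two sum_divide_distrib add_divide_distrib)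
  qed
  have "\<delta>\<^sup>2 \<le> (1/4)\<^sup>2" using \<delta> d4 by (intro power_mono) auto
  then have m34: "m \<ge> 15/16" using B1 by (simp add: power2_eq_square)
  \<comment> \<open>The mean of \<open>q 0\<close> and \<open>q 1\<close> is at least 15/16 and
    neither exceeds 1, so neither can vanish. Hence \<open>x + l b\<close> is an actual value of
    \<open>E\<close> for both \<open>b\<close>, which keeps it between \<open>Emin\<close> and
    \<open>Emax\<close>.\<close>
  have qpos: "q b > 0" if "b < 2" for b
  proof -
    have "b = 0 \<or> b = 1" using that by auto
    then show ?thesis using m34 mq qle[of 0] qle[of 1] by auto
  qed
  have xr: "Emin \<le> x + l b \<and> x + l b \<le> Emax" if "b < 2" for b
  proof -
    have "{k. k < n \<and> E k - l b = x} \<noteq> {}" using qpos[OF that] unfolding q_def by force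
    then obtain k where k: "k < n" "E k - l b = x" by blast
    then have "E k = x + l b" by simp
    then show ?thesis using E[OF k(1)] by simp
  qed
  define \<Delta> where "\<Delta> = Emax - Emin"
  \<comment> \<open>Only the mass \<open>1 - q b\<close> off the atom contributes, and it is
    displaced by at most \<open>\<Delta>\<close>, as \<open>E k\<close> and \<open>x + l b\<close>
    share an interval of that length.\<close>
  have dev: "\<bar>(\<Sum>k<n. p b k * (E k - l b)) - x\<bar> \<le> (1 - q b) * \<Delta>" if b: "b < 2" for b
  proof -
    have "(\<Sum>k<n. p b k * (E k - l b)) - x = (\<Sum>k<n. p b k * (E k - l b)) - (\<Sum>k<n. p b k) * x"
      by (simp add: p1[OF b])
    also have "\<dots> = (\<Sum>k<n. p b k * (E k - l b - x))"
      by (simp add: sum_distrib_right sum_subtractf right_diff_distrib)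
    also have "\<dots> = (\<Sum>k\<in>{k. k < n \<and> E k - l b \<noteq> x}. p b k * (E k - l b - x))"
      by (rule sum.mono_neutral_right) auto
    finally have "\<bar>(\<Sum>k<n. p b k * (E k - l b)) - x\<bar> \<le> (\<Sum>k\<in>{k. k < n \<and> E k - l b \<noteq> x}. \<bar>p b k * (E k - l b - x)\<bar>)"
      by (simp add: sum_abs)
    also have "\<dots> \<le> (\<Sum>k\<in>{k. k < n \<and> E k - l b \<noteq> x}. p b k * \<Delta>)"
    proof (rule sum_mono)
      fix k assume "k \<in> {k. k < n \<and> E k - l b \<noteq> x}"
      then have k: "k < n" by simp
      have "\<bar>E k - l b - x\<bar> \<le> \<Delta>" using E[OF k] xr[OF b] unfolding \<Delta>_def by linarith
      then show "\<bar>p b k * (E k - l b - x)\<bar> \<le> p b k * \<Delta>" using p[OF b k] by (simp add: abs_mult mult_left_mono)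
    qed
    also have "\<dots> = (1 - q b) * \<Delta>"
    proof -
      have "(\<Sum>k\<in>{k. k < n \<and> E k - l b \<noteq> x}. p b k) = 1 - q b" using q1[OF b] by linarith
      then show ?thesis by (simp only: sum_distrib_right[symmetric])
    qed
    finally show ?thesis .
  qed
  have "D \<le> (1 - q 1) * \<Delta> + (1 - q 0) * \<Delta>" using D dev[of 0] dev[of 1] by linarith
  also have "\<dots> = 2 * (1 - m) * \<Delta>" by (simp add: mq field_simps)
  finally have "D / \<Delta> \<le> 2 * (1 - m)" using S by (simp add: \<Delta>_def pos_divide_le_eq)
  define \<eta> where "\<eta> = 1 - m"
  define t where "t = y\<^sup>2 / 2"
  have y0: "y \<ge> 0" "y\<^sup>2 = D / \<Delta>" using D0 S by (auto simp: y \<Delta>_def)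
  have t: "t \<le> \<eta>" "\<eta> \<le> 1/16" using \<open>D / \<Delta> \<le> 2 * (1 - m)\<close> y0 m34 by (auto simp: t_def \<eta>_def)
  have y1: "y \<le> 1"
  proof (rule power2_le_imp_le)
    show "y\<^sup>2 \<le> 1\<^sup>2" using t by (simp add: t_def)
  qed simp
  \<comment> \<open>Twice this product is the increase of \<open>2 * s - 2 * s\<^sup>2\<close> from
    \<open>s = t\<close> to \<open>s = \<eta>\<close>.\<close>
  have "(\<eta> - t) * (1 - \<eta> - t) \<ge> 0" using t by (intro mult_nonneg_nonneg) auto
  then have 1: "2 * t - 2 * t\<^sup>2 \<le> 2 * \<eta> - 2 * \<eta>\<^sup>2" by (simp add: power2_eq_square algebra_simps)
  have 2: "2 * \<eta> - 2 * \<eta>\<^sup>2 \<le> \<delta>\<^sup>2" using B2 by (simp add: \<eta>_def power2_eq_square algebra_simps)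
  \<comment> \<open>With \<open>t = y\<^sup>2 / 2\<close>, this is exactly
    \<open>2 * t - 2 * t\<^sup>2\<close> minus \<open>(y - y\<^sup>2)\<^sup>2\<close>.\<close>
  have "y ^ 3 * (2 - 3/2 * y) \<ge> 0" using y0 y1 by (intro mult_nonneg_nonneg) auto
  then have "(y - y\<^sup>2)\<^sup>2 \<le> 2 * t - 2 * t\<^sup>2" by (simp add: t_def power2_eq_square power3_eq_cube algebra_simps)
  then have "(y - y\<^sup>2)\<^sup>2 \<le> \<delta>\<^sup>2" using 1 2 by simp
  then show ?thesis using \<delta> by (rule power2_le_imp_le)
qed

section \<open>Charge fluctuations\<close>

lemma ip_unitary:
  assumes "unitary n W"
  shows "ip n (mv (dag W) x) (mv (dag W) y) = ip n x y"
proof -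
  have W: "W \<in> carrier_mat n n" "W * dag W = 1\<^sub>m n" using assms by (auto simp: unitary_def)
  have "ip n (mv (dag W) x) (mv (dag W) y) = ip n x (mv W (mv (dag W) y))"
    by (rule ip_mv[OF W(1), symmetric])
  also have "mv W (mv (dag W) y) = mv (1\<^sub>m n) y" using W by (simp add: mv_mult[symmetric])
  also have "ip n x \<dots> = ip n x y" by (intro ip_cong) (auto simp: mv_one)
  finally show ?thesis .
qed

lemma spread_nonneg:
  assumes "hermitian n h" "n > 0"
  shows "spread h \<ge> 0"
proof -
  obtain W and d :: "nat \<Rightarrow> real" where "unitary n W" "h = W * diagm n (\<lambda>i. of_real (d i)) * dag W"
    using hermitian_spectral[OF assms(1)] by blast
  then have "spread h = Max (d ` {..<n}) - Min (d ` {..<n})" using spread_conj_diagm by blast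
  moreover have "Min (d ` {..<n}) \<le> d 0" "d 0 \<le> Max (d ` {..<n})"
    using assms(2) by (auto intro!: Min_le Max_ge)
  ultimately show ?thesis by linarith
qed

text \<open>The two pure states live on the tensor product of the space of \<open>h\<close> with a spectator system
  indexed by \<open>T\<close>. After centring \<open>h\<close> at the midpoint of its spectrum, the bound is Cauchy-Schwarz for
  \<open>|a|\<^sup>2 - |b|\<^sup>2 = Re ((a - b) (a + b)\<^sup>*)\<close>.\<close>

lemma expectation_difference_le:
  fixes u v :: "'t \<Rightarrow> nat \<Rightarrow> complex"
  assumes T: "finite T" and h: "hermitian n h"
    and u: "(\<Sum>t\<in>T. nsq n (u t)) = 1" and v: "(\<Sum>t\<in>T. nsq n (v t)) = 1"
    and r: "r = (\<Sum>t\<in>T. Re (ip n (u t) (v t)))"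
  shows "r\<^sup>2 \<le> 1"
    and "\<bar>(\<Sum>t\<in>T. Re (ip n (u t) (mv h (u t)))) - (\<Sum>t\<in>T. Re (ip n (v t) (mv h (v t))))\<bar> \<le> spread h * sqrt (1 - r\<^sup>2)"
proof -
  have n: "n > 0" using u by (cases n) (auto simp: nsq_def)
  obtain W and d :: "nat \<Rightarrow> real" where W: "unitary n W" and hd: "h = W * diagm n (\<lambda>i. of_real (d i)) * dag W"
    using hermitian_spectral[OF h] by blast
  have Wc: "W \<in> carrier_mat n n" using W by (simp add: unitary_def)
  define hi lo where "hi = Max (d ` {..<n})" and "lo = Min (d ` {..<n})"
  have sp: "spread h = hi - lo" unfolding hd hi_def lo_def by (rule spread_conj_diagm[OF W])
  have dk: "lo \<le> d k" "d k \<le> hi" if "k < n" for k using that by (auto simp: hi_def lo_def)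
  define c where "c = (hi + lo) / 2"
  have dc: "\<bar>d k - c\<bar> \<le> spread h / 2" if "k < n" for k
    using dk[OF that] unfolding c_def sp by (simp add: abs_le_iff field_simps)
  define I where "I = T \<times> {..<n}"
  have I: "finite I" using T by (simp add: I_def)
  define a where "a = (\<lambda>(t,k). mv (dag W) (u t) k)"
  define b where "b = (\<lambda>(t,k). mv (dag W) (v t) k)"
  have sumI: "(\<Sum>i\<in>I. g i) = (\<Sum>t\<in>T. \<Sum>k<n. g (t,k))" for g :: "'t \<times> nat \<Rightarrow> real"
    by (simp add: I_def sum.cartesian_product)
  have nsqW: "(\<Sum>k<n. (cmod (mv (dag W) x k))\<^sup>2) = nsq n x" for x
  proof -
    have "complex_of_real (nsq n (mv (dag W) x)) = of_real (nsq n x)"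
      using ip_unitary[OF W, of x x] by (simp only: ip_self)
    then show ?thesis by (simp only: of_real_eq_iff nsq_def)
  qed
  have na: "(\<Sum>i\<in>I. (cmod (a i))\<^sup>2) = 1" and nb: "(\<Sum>i\<in>I. (cmod (b i))\<^sup>2) = 1"
    unfolding sumI by (simp_all add: a_def b_def nsqW u v)
  have ab: "(\<Sum>i\<in>I. Re (cnj (a i) * b i)) = r"
  proof -
    have "(\<Sum>k<n. Re (cnj (mv (dag W) x k) * mv (dag W) y k)) = Re (ip n x y)" for x y
      using ip_unitary[OF W, of x y] by (simp only: ip_def Re_sum[symmetric])
    then show ?thesis unfolding sumI r a_def b_def by (simp only: split_conv)
  qed
  have nn: "(cmod (x + y))\<^sup>2 = (cmod x)\<^sup>2 + (cmod y)\<^sup>2 + 2 * Re (cnj x * y)" 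
    "(cmod (x - y))\<^sup>2 = (cmod x)\<^sup>2 + (cmod y)\<^sup>2 - 2 * Re (cnj x * y)" for x y
    unfolding cmod_power2 by (simp_all add: power2_eq_square algebra_simps)
  have plus: "(\<Sum>i\<in>I. (cmod (a i + b i))\<^sup>2) = 2 + 2 * r" and minus: "(\<Sum>i\<in>I. (cmod (a i - b i))\<^sup>2) = 2 - 2 * r"
    unfolding nn sum.distrib sum_subtractf sum_distrib_left[symmetric] na nb ab by simp_all
  have "2 + 2 * r \<ge> 0" "2 - 2 * r \<ge> 0"
    unfolding plus[symmetric] minus[symmetric] by (auto intro: sum_nonneg)
  then have rr: "\<bar>r\<bar> \<le> 1" by linarith
  then show "r\<^sup>2 \<le> 1" by (simp add: abs_square_le_1)
  have Q: "Re (ip n x (mv h x)) = (\<Sum>k<n. d k * (cmod (mv (dag W) x k))\<^sup>2)" for x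
  proof -
    have "ip n x (mv h x) = (\<Sum>k<n. of_real (d k * (cmod (mv (dag W) x k))\<^sup>2))"
      unfolding hd ip_conj_diagm[OF Wc] of_real_mult complex_norm_square by (simp only: mult_ac)
    then show ?thesis by (simp only: Re_sum Re_complex_of_real)
  qed
  have "(\<Sum>t\<in>T. Re (ip n (u t) (mv h (u t)))) - (\<Sum>t\<in>T. Re (ip n (v t) (mv h (v t))))
     = (\<Sum>i\<in>I. d (snd i) * (cmod (a i))\<^sup>2) - (\<Sum>i\<in>I. d (snd i) * (cmod (b i))\<^sup>2)"
    unfolding sumI Q by (simp add: a_def b_def)
  \<comment> \<open>Both vectors are normalised, so subtracting \<open>c\<close> times the
    difference of their squared norms adds 0 and replaces each \<open>d k\<close> by
    \<open>d k - c\<close>, at most half the spread in modulus.\<close>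
  also have "\<dots> = (\<Sum>i\<in>I. d (snd i) * (cmod (a i))\<^sup>2) - (\<Sum>i\<in>I. d (snd i) * (cmod (b i))\<^sup>2) 
     - c * ((\<Sum>i\<in>I. (cmod (a i))\<^sup>2) - (\<Sum>i\<in>I. (cmod (b i))\<^sup>2))"
    by (simp add: na nb)
  also have "\<dots> = (\<Sum>i\<in>I. (d (snd i) - c) * ((cmod (a i))\<^sup>2 - (cmod (b i))\<^sup>2))"
    by (simp add: sum_distrib_left sum_subtractf algebra_simps sum.distrib)
  finally have "\<bar>(\<Sum>t\<in>T. Re (ip n (u t) (mv h (u t)))) - (\<Sum>t\<in>T. Re (ip n (v t) (mv h (v t))))\<bar>
     \<le> (\<Sum>i\<in>I. \<bar>(d (snd i) - c) * ((cmod (a i))\<^sup>2 - (cmod (b i))\<^sup>2)\<bar>)" by (simp add: sum_abs)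
  also have "\<dots> \<le> (\<Sum>i\<in>I. spread h / 2 * (\<bar>cmod (a i - b i)\<bar> * \<bar>cmod (a i + b i)\<bar>))"
  proof (rule sum_mono)
    fix i assume "i \<in> I"
    then have i: "snd i < n" by (auto simp: I_def)
    have "(cmod (a i))\<^sup>2 - (cmod (b i))\<^sup>2 = Re ((a i - b i) * cnj (a i + b i))"
      unfolding cmod_power2 by (simp add: power2_eq_square algebra_simps)
    then have "\<bar>(cmod (a i))\<^sup>2 - (cmod (b i))\<^sup>2\<bar> \<le> cmod ((a i - b i) * cnj (a i + b i))"
      by (simp only: abs_Re_le_cmod)
    then have "\<bar>(cmod (a i))\<^sup>2 - (cmod (b i))\<^sup>2\<bar> \<le> \<bar>cmod (a i - b i)\<bar> * \<bar>cmod (a i + b i)\<bar>"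
      by (simp only: norm_mult complex_mod_cnj abs_norm_cancel)
    then show "\<bar>(d (snd i) - c) * ((cmod (a i))\<^sup>2 - (cmod (b i))\<^sup>2)\<bar> \<le> spread h / 2 * (\<bar>cmod (a i - b i)\<bar> * \<bar>cmod (a i + b i)\<bar>)"
      unfolding abs_mult using dc[OF i] spread_nonneg[OF h n] by (intro mult_mono) auto
  qed
  also have "\<dots> = spread h / 2 * (\<Sum>i\<in>I. \<bar>cmod (a i - b i)\<bar> * \<bar>cmod (a i + b i)\<bar>)"
    by (simp add: sum_distrib_left)
  also have "\<dots> \<le> spread h / 2 * (sqrt (2 - 2 * r) * sqrt (2 + 2 * r))"
    using L2_set_mult_ineq[of "\<lambda>i. cmod (a i - b i)" "\<lambda>i. cmod (a i + b i)" I] spread_nonneg[OF h n]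
    unfolding L2_set_def plus minus by (intro mult_left_mono) auto
  also have "sqrt (2 - 2 * r) * sqrt (2 + 2 * r) = sqrt (4 * (1 - r\<^sup>2))"
    unfolding real_sqrt_mult[symmetric] by (simp add: algebra_simps power2_eq_square)
  also have "\<dots> = 2 * sqrt (1 - r\<^sup>2)" unfolding real_sqrt_mult by simp
  finally show "\<bar>(\<Sum>t\<in>T. Re (ip n (u t) (mv h (u t)))) - (\<Sum>t\<in>T. Re (ip n (v t) (mv h (v t))))\<bar> \<le> spread h * sqrt (1 - r\<^sup>2)"
    by simp
qed

section \<open>Kraus sums as inner products of Kraus images\<close>

lemma mat_sum_quadratic:
  assumes M: "\<And>i j. i < n \<Longrightarrow> j < n \<Longrightarrow> M $$ (i,j) = (\<Sum>t\<in>T. c t * A t $$ (i,j))" "M \<in> carrier_mat n n"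
    and A: "\<And>t. t \<in> T \<Longrightarrow> A t \<in> carrier_mat n n"
  shows "ip n x (mv M y) = (\<Sum>t\<in>T. c t * ip n x (mv (A t) y))"
proof -
  have e: "ip n x (mv B y) = (\<Sum>i<n. \<Sum>j<n. cnj (x i) * B $$ (i,j) * y j)" if "B \<in> carrier_mat n n" for B
    using that by (auto simp: ip_def mv_def sum_distrib_left mult.assoc intro!: sum.cong)
  have "ip n x (mv M y) = (\<Sum>i<n. \<Sum>j<n. \<Sum>t\<in>T. c t * (cnj (x i) * A t $$ (i,j) * y j))"
    unfolding e[OF M(2)] 
    by (intro sum.cong refl) (simp add: M(1) sum_distrib_left sum_distrib_right mult_ac)
  also have "\<dots> = (\<Sum>i<n. \<Sum>t\<in>T. \<Sum>j<n. c t * (cnj (x i) * A t $$ (i,j) * y j))"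
    by (rule sum.cong[OF refl]) (rule sum.swap)
  also have "\<dots> = (\<Sum>t\<in>T. \<Sum>i<n. \<Sum>j<n. c t * (cnj (x i) * A t $$ (i,j) * y j))" by (rule sum.swap)
  also have "\<dots> = (\<Sum>t\<in>T. c t * ip n x (mv (A t) y))"
    using A by (intro sum.cong refl) (simp add: e sum_distrib_left)
  finally show ?thesis .
qed

lemma ip_dag_mult:
  assumes "A \<in> carrier_mat m n" "B \<in> carrier_mat m n"
  shows "ip n x (mv (dag A * B) y) = ip m (mv A x) (mv B y)"
  using ip_mv[OF dag_carrier[OF assms(1)], of x "mv B y"] assms by (simp add: mv_mult)

text \<open>The completeness relation says that stacking the vectors \<open>mv (Ks ! k) x\<close> is
  an isometry, the dilation of the channel.\<close>

lemma kraus_channel_ip: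
  assumes "kraus_channel n m Ks"
  shows "(\<Sum>k<length Ks. ip m (mv (Ks ! k) x) (mv (Ks ! k) y)) = ip n x y"
proof -
  have K: "Ks ! k \<in> carrier_mat m n" if "k < length Ks" for k
    using assms that by (auto simp: kraus_channel_def)
  have one: "1\<^sub>m n = mat n n (\<lambda>(a,b). \<Sum>K\<leftarrow>Ks. (dag K * K) $$ (a,b))"
    using assms by (simp add: kraus_channel_def)
  have "ip n x (mv (1\<^sub>m n) y) = (\<Sum>k<length Ks. 1 * ip n x (mv (dag (Ks ! k) * Ks ! k) y))"
  proof (rule mat_sum_quadratic)
    show "1\<^sub>m n $$ (i,j) = (\<Sum>k<length Ks. 1 * (dag (Ks ! k) * Ks ! k) $$ (i,j))" if "i < n" "j < n" for i j
      unfolding one using that by (simp add: sum_list_map_nth)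
    show "dag (Ks ! k) * Ks ! k \<in> carrier_mat n n" if "k \<in> {..<length Ks}" for k
      using K[of k] that by (intro mult_carrier_mat[of _ n m]) auto
  qed auto
  also have "\<dots> = (\<Sum>k<length Ks. ip m (mv (Ks ! k) x) (mv (Ks ! k) y))"
    using K by (intro sum.cong refl) (simp add: ip_dag_mult)
  finally show ?thesis by (simp add: mv_one cong: ip_cong)
qed

lemma isometry_ip:
  assumes "V \<in> carrier_mat m n" "dag V * V = 1\<^sub>m n"
  shows "ip m (mv V x) (mv V y) = ip n x y"
  unfolding ip_dag_mult[OF assms(1,1), symmetric] assms(2) by (simp add: mv_one cong: ip_cong)

lemma kraus_comb_ip:
  assumes "\<And>K. K \<in> set Ks \<Longrightarrow> K \<in> carrier_mat n n"
  shows "ip n x (mv (kraus_comb n Ks c) y) = 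
    (\<Sum>i<length Ks. \<Sum>j<length Ks. c i j * ip n (mv (Ks ! i) x) (mv (Ks ! j) y))"
proof -
  have K: "Ks ! k \<in> carrier_mat n n" if "k < length Ks" for k using assms that by auto
  let ?T = "{..<length Ks} \<times> {..<length Ks}"
  have "ip n x (mv (kraus_comb n Ks c) y) = (\<Sum>t\<in>?T. c (fst t) (snd t) * ip n x (mv (dag (Ks ! fst t) * Ks ! snd t) y))"
  proof (rule mat_sum_quadratic)
    show "kraus_comb n Ks c $$ (a,b) = (\<Sum>t\<in>?T. c (fst t) (snd t) * (dag (Ks ! fst t) * Ks ! snd t) $$ (a,b))" if "a < n" "b < n" for a b
      using that by (simp add: kraus_comb_def sum.cartesian_product case_prod_unfold)
    show "dag (Ks ! fst t) * Ks ! snd t \<in> carrier_mat n n" if "t \<in> ?T" for t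
      using K that by (intro mult_carrier_mat[of _ n n]) auto
  qed (simp add: kraus_comb_def)
  also have "\<dots> = (\<Sum>t\<in>?T. c (fst t) (snd t) * ip n (mv (Ks ! fst t) x) (mv (Ks ! snd t) y))"
    using K by (intro sum.cong refl) (auto simp: ip_dag_mult[of _ n n])
  finally show ?thesis by (simp add: sum.cartesian_product case_prod_unfold)
qed

lemma sum_comp_kraus:
  "(\<Sum>K\<leftarrow>comp_kraus R (comp_kraus Ks [V]). f K) = (\<Sum>i<length Ks. \<Sum>a<length R. f (R ! a * (Ks ! i * V)))"
proof -
  have "(\<Sum>K\<leftarrow>concat (map (\<lambda>K1. map (\<lambda>K2. g K2 K1) R) Ls). f K) = (\<Sum>K1\<leftarrow>Ls. \<Sum>K2\<leftarrow>R. f (g K2 K1))" for g Ls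
    by (induction Ls) (auto simp: o_def)
  then show ?thesis by (simp add: comp_kraus_def o_def sum_list_map_nth)
qed

text \<open>In the dilated output, the noise index \<open>i\<close> is the environment on which
  \<open>h\<close> acts, while the recovery index and the logical index form the spectator
  \<open>T\<close>. The output \<open>u b\<close> of \<open>w b\<close> is compared with the product
  vector \<open>v b\<close>, in which \<open>h\<close> has the same expectation for both
  \<open>b\<close>. The two resulting errors are combined through the sum of the overlaps.\<close>

lemma charge_fluctuation_bound:
  fixes w :: "nat \<Rightarrow> nat \<Rightarrow> complex"
  assumes V: "V \<in> carrier_mat dS dL" "dag V * V = 1\<^sub>m dL"
    and Ks: "kraus_channel dS dS Ks" and R: "kraus_channel dS dL R"
    and w: "\<And>b. b < 2 \<Longrightarrow> nsq dL (w b) = 1"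
    and h: "hermitian (length Ks) h" and HS: "HS = kraus_comb dS Ks (\<lambda>i j. h $$ (i,j))"
    and F: "F = (\<Sum>K\<leftarrow>comp_kraus R (comp_kraus Ks [V]). (cmod ((\<Sum>b<2. ip dL (w b) (mv K (w b))) / 2))\<^sup>2)"
    and \<mu>: "\<And>b. \<mu> b = Re (ip dS (mv V (w b)) (mv HS (mv V (w b))))"
  shows "F \<le> 1" "\<bar>\<mu> 0 - \<mu> 1\<bar> \<le> 2 * spread h * sqrt (1 - F)"
proof -
  let ?n = "length Ks" and ?q = "length R"
  have K: "Ks ! i \<in> carrier_mat dS dS" if "i < ?n" for i using Ks that by (auto simp: kraus_channel_def)
  have Rc: "R ! a \<in> carrier_mat dL dS" if "a < ?q" for a using R that by (auto simp: kraus_channel_def)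
  define x where "x b i = mv (Ks ! i) (mv V (w b))" for b i
  define A where "A b i a = mv (R ! a) (x b i)" for b i a
  have Amv: "mv (R ! a * (Ks ! i * V)) (w b) = A b i a" if "i < ?n" "a < ?q" for i a b
    using K[OF that(1)] Rc[OF that(2)] V(1) by (simp add: A_def x_def mv_mult)
  \<comment> \<open>The common environment state, not yet normalised: the mean over \<open>b\<close>
    of the component of the output along \<open>w b\<close>. Its squared norm is
    \<open>F\<close>.\<close>
  define \<zeta> where "\<zeta> i a = (\<Sum>b<2. ip dL (w b) (A b i a)) / 2" for i a
  have F\<zeta>: "F = (\<Sum>i<?n. \<Sum>a<?q. (cmod (\<zeta> i a))\<^sup>2)"
    unfolding F sum_comp_kraus by (intro sum.cong refl) (simp add: Amv \<zeta>_def)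
  define T where "T = {..<?q} \<times> {..<dL}"
  have T: "finite T" by (simp add: T_def)
  have sumT: "(\<Sum>t\<in>T. g t) = (\<Sum>a<?q. \<Sum>l<dL. g (a,l))" for g :: "nat \<times> nat \<Rightarrow> 'x::comm_monoid_add"
    by (simp add: T_def sum.cartesian_product)
  define u where "u b t i = A b i (fst t) (snd t)" for b t i
  have ipu: "(\<Sum>t\<in>T. cnj (u b t i) * u b t j) = ip dS (x b i) (x b j)" for b i j
  proof -
    have "(\<Sum>t\<in>T. cnj (u b t i) * u b t j) = (\<Sum>a<?q. ip dL (mv (R ! a) (x b i)) (mv (R ! a) (x b j)))"
      unfolding sumT ip_def by (simp add: u_def A_def)
    then show ?thesis by (simp only: kraus_channel_ip[OF R])
  qed
  have nu: "(\<Sum>t\<in>T. nsq ?n (u b t)) = 1" if "b < 2" for b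
  proof -
    have "complex_of_real (\<Sum>t\<in>T. nsq ?n (u b t)) = (\<Sum>t\<in>T. \<Sum>i<?n. cnj (u b t i) * u b t i)"
      by (simp add: ip_self[symmetric] ip_def)
    also have "\<dots> = (\<Sum>i<?n. \<Sum>t\<in>T. cnj (u b t i) * u b t i)" by (rule sum.swap)
    also have "\<dots> = ip dS (mv V (w b)) (mv V (w b))"
      unfolding ipu unfolding x_def by (rule kraus_channel_ip[OF Ks])
    also have "\<dots> = ip dL (w b) (w b)" by (rule isometry_ip[OF V])
    also have "\<dots> = of_real 1" using w[OF that] by (simp add: ip_self)
    finally show ?thesis by (simp only: of_real_eq_iff)
  qed
  have Qu: "(\<Sum>t\<in>T. Re (ip ?n (u b t) (mv h (u b t)))) = \<mu> b" for b
  proof -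
    have hc: "h \<in> carrier_mat ?n ?n" using h by (simp add: hermitian_def)
    have "(\<Sum>t\<in>T. ip ?n (u b t) (mv h (u b t))) = (\<Sum>t\<in>T. \<Sum>i<?n. \<Sum>j<?n. h $$ (i,j) * (cnj (u b t i) * u b t j))"
      using hc by (intro sum.cong refl) (auto simp: ip_def mv_def sum_distrib_left mult_ac intro!: sum.cong)
    also have "\<dots> = (\<Sum>i<?n. \<Sum>t\<in>T. \<Sum>j<?n. h $$ (i,j) * (cnj (u b t i) * u b t j))" by (rule sum.swap)
    also have "\<dots> = (\<Sum>i<?n. \<Sum>j<?n. \<Sum>t\<in>T. h $$ (i,j) * (cnj (u b t i) * u b t j))"
      by (rule sum.cong[OF refl]) (rule sum.swap)
    also have "\<dots> = (\<Sum>i<?n. \<Sum>j<?n. h $$ (i,j) * ip dS (x b i) (x b j))"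
      by (simp only: sum_distrib_left[symmetric] ipu)
    also have "\<dots> = ip dS (mv V (w b)) (mv HS (mv V (w b)))"
      unfolding HS x_def using Ks by (subst kraus_comb_ip) (auto simp: kraus_channel_def)
    finally show ?thesis by (simp only: \<mu> Re_sum[symmetric])
  qed
  have n: "?n > 0" using nu[of 0] by (cases "?n") (auto simp: nsq_def)
  have sp: "spread h \<ge> 0" by (rule spread_nonneg[OF h n])
  have F0: "F \<ge> 0" unfolding F\<zeta> by (intro sum_nonneg) auto
  have "F \<le> 1 \<and> \<bar>\<mu> 0 - \<mu> 1\<bar> \<le> 2 * spread h * sqrt (1 - F)"
  proof (cases "F = 0")
    \<comment> \<open>Here \<open>\<zeta>\<close> vanishes and cannot be normalised, but comparing
      \<open>u 0\<close> with \<open>u 1\<close> directly gives the bound \<open>spread h\<close>,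
      which is enough.\<close>
    case True
    define r where "r = (\<Sum>t\<in>T. Re (ip ?n (u 0 t) (u 1 t)))"
    have "\<bar>\<mu> 0 - \<mu> 1\<bar> \<le> spread h * sqrt (1 - r\<^sup>2)"
      using expectation_difference_le(2)[OF T h nu[of 0] nu[of 1] r_def] unfolding Qu by simp
    also have "\<dots> \<le> spread h * 1" by (intro mult_left_mono sp) simp
    finally show ?thesis using True sp by simp
  next
    case False
    define f where "f = sqrt F"
    have f: "f > 0" "f\<^sup>2 = F" using False F0 by (auto simp: f_def)
    define v where "v b t i = w b (snd t) * (\<zeta> i (fst t) / of_real f)" for b t i
    have nv: "(\<Sum>t\<in>T. nsq ?n (v b t)) = 1" if "b < 2" for b
    proof -
      have "(\<Sum>t\<in>T. nsq ?n (v b t)) = (\<Sum>a<?q. \<Sum>l<dL. \<Sum>i<?n. (cmod (w b l))\<^sup>2 * ((cmod (\<zeta> i a))\<^sup>2 / F))"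
        unfolding sumT nsq_def v_def using f
        by (simp add: norm_mult norm_divide power_mult_distrib power_divide)
      also have "\<dots> = (\<Sum>a<?q. (\<Sum>l<dL. (cmod (w b l))\<^sup>2) * (\<Sum>i<?n. (cmod (\<zeta> i a))\<^sup>2 / F))"
        by (simp only: sum_product)
      also have "\<dots> = (\<Sum>a<?q. \<Sum>i<?n. (cmod (\<zeta> i a))\<^sup>2 / F)"
        using w[OF that] by (simp add: nsq_def)
      also have "\<dots> = (\<Sum>i<?n. \<Sum>a<?q. (cmod (\<zeta> i a))\<^sup>2 / F)" by (rule sum.swap)
      also have "\<dots> = F / F" by (simp only: sum_divide_distrib[symmetric] F\<zeta>[symmetric])
      finally show ?thesis using False by simp
    qed
    define r where "r b = (\<Sum>t\<in>T. Re (ip ?n (u b t) (v b t)))" for b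
    have rb: "r b = Re (\<Sum>i<?n. \<Sum>a<?q. ip dL (A b i a) (w b) * (\<zeta> i a / of_real f))" for b
    proof -
      have "(\<Sum>t\<in>T. ip ?n (u b t) (v b t)) = (\<Sum>i<?n. \<Sum>t\<in>T. cnj (u b t i) * v b t i)"
        unfolding ip_def by (rule sum.swap)
      also have "\<dots> = (\<Sum>i<?n. \<Sum>a<?q. ip dL (A b i a) (w b) * (\<zeta> i a / of_real f))"
        unfolding sumT ip_def sum_distrib_right u_def v_def by (simp add: mult_ac)
      finally show ?thesis unfolding r_def by (simp only: Re_sum[symmetric])
    qed
    \<comment> \<open>As \<open>\<zeta>\<close> is the mean overlap, summing over \<open>b\<close>
      turns each term into a multiple of its squared modulus.\<close>
    have r01: "r 0 + r 1 = 2 * f"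
    proof -
      have "r 0 + r 1 = Re (\<Sum>i<?n. \<Sum>a<?q. (ip dL (A 0 i a) (w 0) + ip dL (A 1 i a) (w 1)) * (\<zeta> i a / of_real f))"
        unfolding rb by (simp only: sum.distrib distrib_right plus_complex.sel)
      also have "\<dots> = Re (\<Sum>i<?n. \<Sum>a<?q. of_real (2 / f * (cmod (\<zeta> i a))\<^sup>2))"
      proof -
        have "(ip dL (A 0 i a) (w 0) + ip dL (A 1 i a) (w 1)) * (\<zeta> i a / of_real f) = of_real (2 / f * (cmod (\<zeta> i a))\<^sup>2)" for i a
        proof -
          have "ip dL (A 0 i a) (w 0) + ip dL (A 1 i a) (w 1) = 2 * cnj (\<zeta> i a)"
            by (simp add: \<zeta>_def numeral_2_eq_2 cnj_ip)
          then show ?thesis by (simp add: complex_norm_square[symmetric] mult_ac)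
        qed
        then show ?thesis by (simp only:)
      qed
      also have "\<dots> = 2 / f * F" unfolding F\<zeta>
        by (simp only: of_real_sum[symmetric] Re_complex_of_real sum_distrib_left[symmetric])
      also have "\<dots> = 2 * f" unfolding f(2)[symmetric] using f(1) by (simp add: power2_eq_square)
      finally show ?thesis .
    qed
    define Z where "Z = (\<Sum>t\<in>T. Re (ip ?n (v 0 t) (mv h (v 0 t))))"
    \<comment> \<open>In a product vector the normalised factor \<open>w b\<close> sums to 1,
      leaving only the environment factor, which is independent of \<open>b\<close>.\<close>
    have Z1: "(\<Sum>t\<in>T. Re (ip ?n (v b t) (mv h (v b t)))) = Z" if b: "b < 2" for b
    proof -
      have "(\<Sum>t\<in>T. Re (ip ?n (v b t) (mv h (v b t)))) = 
        (\<Sum>a<?q. Re (ip ?n (\<lambda>i. \<zeta> i a / of_real f) (mv h (\<lambda>i. \<zeta> i a / of_real f))))" if b: "b < 2" for b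
      proof -
        have *: "ip ?n (v b (a,l)) (mv h (v b (a,l))) = 
          of_real ((cmod (w b l))\<^sup>2) * ip ?n (\<lambda>i. \<zeta> i a / of_real f) (mv h (\<lambda>i. \<zeta> i a / of_real f))" for a l
        proof -
          have mvh: "mv h (v b (a,l)) = (\<lambda>i. w b l * mv h (\<lambda>i. \<zeta> i a / of_real f) i)"
            by (rule ext) (simp add: mv_def v_def sum_distrib_left mult_ac)
          show ?thesis
            unfolding mvh complex_norm_square ip_def sum_distrib_left by (simp add: v_def mult_ac)
        qed
        have "(\<Sum>l<dL. Re (ip ?n (v b (a,l)) (mv h (v b (a,l))))) = 
          nsq dL (w b) * Re (ip ?n (\<lambda>i. \<zeta> i a / of_real f) (mv h (\<lambda>i. \<zeta> i a / of_real f)))" for a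
          unfolding * Re_complex_of_real nsq_def by (simp add: sum_distrib_right)
        then show ?thesis unfolding sumT using w[OF b] by simp
      qed
      from this[OF b] this[of 0] show ?thesis unfolding Z_def by simp
    qed
    have rsq: "(r b)\<^sup>2 \<le> 1" and dif: "\<bar>\<mu> b - Z\<bar> \<le> spread h * sqrt (1 - (r b)\<^sup>2)" if "b < 2" for b
      using expectation_difference_le[OF T h nu[OF that] nv[OF that] r_def[of b]] unfolding Qu Z1[OF that] .
    have ff: "4 * F = (r 0 + r 1)\<^sup>2" unfolding r01 f(2)[symmetric] by (simp add: power_mult_distrib)
    have conv: "(r 0 + r 1)\<^sup>2 \<le> 2 * ((r 0)\<^sup>2 + (r 1)\<^sup>2)"
      using zero_le_power2[of "r 0 - r 1"] by (simp add: power2_eq_square algebra_simps)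
    have F1: "F \<le> 1" using ff conv rsq[of 0] rsq[of 1] by simp
    define s where "s b = sqrt (1 - (r b)\<^sup>2)" for b
    have s2: "(s 0)\<^sup>2 = 1 - (r 0)\<^sup>2" "(s 1)\<^sup>2 = 1 - (r 1)\<^sup>2" using rsq[of 0] rsq[of 1] by (auto simp: s_def)
    \<comment> \<open>The inequality between arithmetic and quadratic mean enters twice: for
      \<open>s 0\<close>, \<open>s 1\<close>, and in \<open>conv\<close> for the overlaps, whose
      squares sum to at least \<open>2 * F\<close>.\<close>
    have "s 0 + s 1 \<le> 2 * sqrt (1 - F)"
    proof (rule power2_le_imp_le)
      have "(s 0 + s 1)\<^sup>2 \<le> 2 * ((s 0)\<^sup>2 + (s 1)\<^sup>2)"
        using zero_le_power2[of "s 0 - s 1"] by (simp add: power2_eq_square algebra_simps)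
      also have "\<dots> \<le> 4 * (1 - F)" using ff conv unfolding s2 by simp
      also have "\<dots> = (2 * sqrt (1 - F))\<^sup>2" using F1 by (simp add: power_mult_distrib)
      finally show "(s 0 + s 1)\<^sup>2 \<le> (2 * sqrt (1 - F))\<^sup>2" .
    qed (use F1 in simp)
    then have "spread h * (s 0 + s 1) \<le> spread h * (2 * sqrt (1 - F))" by (rule mult_left_mono[OF _ sp])
    moreover have "\<bar>\<mu> 0 - \<mu> 1\<bar> \<le> spread h * (s 0 + s 1)"
      using dif[of 0] dif[of 1] unfolding s_def distrib_left by linarith
    ultimately show ?thesis using F1 by simp
  qed
  then show "F \<le> 1" "\<bar>\<mu> 0 - \<mu> 1\<bar> \<le> 2 * spread h * sqrt (1 - F)" by auto
qed

section \<open>Covariance violation\<close>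

text \<open>The witness discards its input and prepares basis state 0, with \<open>K i\<close>
  mapping basis vector \<open>i\<close> to it. It makes the set of recoveries nonempty, so the
  infimum in \<open>qec_inacc\<close> is meaningful.\<close>

lemma kraus_channel_exists:
  assumes "m > 0"
  shows "\<exists>R. kraus_channel n m R"
proof
  define K :: "nat \<Rightarrow> complex mat" where "K i = mat m n (\<lambda>(a,b). if a = 0 \<and> b = i then 1 else 0)" for i
  have KK: "(dag (K i) * K i) $$ (a,b) = (if a = i \<and> b = i then 1 else 0)" if "a < n" "b < n" for i a b
    using that assms
    by (subst index_mult_mat_sum; simp add: K_def) (subst sum_lessThan_single[of 0], auto)
  have "(\<Sum>M\<leftarrow>map K [0..<n]. (dag M * M) $$ (a,b)) = (if a = b then 1 else 0)" if "a < n" "b < n" for a b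
    using that unfolding sum_list_map_nth
    by (subst sum_lessThan_single[of a]) (auto simp: KK simp del: index_mult_mat(1))
  then show "kraus_channel n m (map K [0..<n])"
    unfolding kraus_channel_def by (auto simp: K_def intro!: eq_matI)
qed

text \<open>As \<open>H\<close> is hermitian, the conjugate transpose of a coefficient array
  represents it too, and so does the average of the two, which is hermitian. Hence the set in
  \<open>frakJ\<close> is nonempty.\<close>

lemma hermitian_kraus_coefficients:
  assumes HS: "hermitian n H" "H = kraus_comb n Ks c" and K: "\<And>K. K \<in> set Ks \<Longrightarrow> K \<in> carrier_mat n n"
  obtains h where "hermitian (length Ks) h" "H = kraus_comb n Ks (\<lambda>i j. h $$ (i,j))"
proof -
  define h where "h = mat (length Ks) (length Ks) (\<lambda>(i,j). (c i j + cnj (c j i)) / 2)"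
  have herm: "hermitian (length Ks) h"
    unfolding hermitian_def h_def by (auto simp: add.commute intro!: eq_matI)
  let ?G = "\<lambda>i j a b. (dag (Ks ! i) * Ks ! j) $$ (a,b)"
  have G: "cnj (?G i j b a) = ?G j i a b" if "i < length Ks" "j < length Ks" "a < n" "b < n" for i j a b
  proof -
    have Kc: "Ks ! i \<in> carrier_mat n n" "Ks ! j \<in> carrier_mat n n" using K that by auto
    have "dag (dag (Ks ! i) * Ks ! j) = dag (Ks ! j) * Ks ! i"
      using Kc by (simp add: dag_mult)
    then have "?G j i a b = dag (dag (Ks ! i) * Ks ! j) $$ (a,b)" by simp
    also have "\<dots> = cnj (?G i j b a)" by (rule index_dag) (use Kc that in auto)
    finally show ?thesis by simp
  qed
  have "H = kraus_comb n Ks (\<lambda>i j. h $$ (i,j))"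
  proof (rule eq_matI)
    fix a b assume "a < dim_row (kraus_comb n Ks (\<lambda>i j. h $$ (i,j)))" "b < dim_col (kraus_comb n Ks (\<lambda>i j. h $$ (i,j)))"
    then have ab: "a < n" "b < n" by (auto simp: kraus_comb_def)
    let ?n = "length Ks"
    have 1: "H $$ (a,b) = (\<Sum>i<?n. \<Sum>j<?n. c i j * ?G i j a b)" if "a < n" "b < n" for a b
      unfolding HS(2) kraus_comb_def using that by (simp del: index_mult_mat(1))
    have "H $$ (a,b) = cnj (H $$ (b,a))" using hermitian_index[OF HS(1) ab(2,1)] by simp
    also have "\<dots> = (\<Sum>i<?n. \<Sum>j<?n. cnj (c i j) * ?G j i a b)"
      unfolding 1[OF ab(2,1)] cnj_sum complex_cnj_mult using ab by (intro sum.cong refl) (simp only: G lessThan_iff)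
    also have "\<dots> = (\<Sum>j<?n. \<Sum>i<?n. cnj (c i j) * ?G j i a b)" by (rule sum.swap)
    finally have 2: "H $$ (a,b) = (\<Sum>i<?n. \<Sum>j<?n. cnj (c j i) * ?G i j a b)" .
    have "H $$ (a,b) = (H $$ (a,b) + H $$ (a,b)) / 2" by simp
    also have "\<dots> = ((\<Sum>i<?n. \<Sum>j<?n. c i j * ?G i j a b) + (\<Sum>i<?n. \<Sum>j<?n. cnj (c j i) * ?G i j a b)) / 2"
      by (subst (2) 2, subst 1[OF ab]) (rule refl)
    also have "\<dots> = (\<Sum>i<?n. \<Sum>j<?n. (c i j + cnj (c j i)) / 2 * ?G i j a b)"
      unfolding sum.distrib[symmetric] sum_divide_distrib
      by (simp only: distrib_right[symmetric] times_divide_eq_left)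
    also have "\<dots> = (\<Sum>i<?n. \<Sum>j<?n. h $$ (i,j) * ?G i j a b)"
      by (intro sum.cong refl) (simp add: h_def del: index_mult_mat(1))
    finally show "H $$ (a,b) = kraus_comb n Ks (\<lambda>i j. h $$ (i,j)) $$ (a,b)"
      using ab by (simp add: kraus_comb_def del: index_mult_mat(1))
  qed (use HS(1) in \<open>auto simp: kraus_comb_def hermitian_def\<close>)
  then show ?thesis using that herm by blast
qed

lemma nonscalar_eigenvalues_differ:
  assumes U: "unitary n U" and A: "A = U * diagm n (\<lambda>i. of_real (d i)) * dag U" and ns: "\<nexists>c. A = c \<cdot>\<^sub>m 1\<^sub>m n"
  obtains k where "k < n" "d k \<noteq> d 0"
proof (rule ccontr)
  assume "\<not> thesis"
  then have const: "\<forall>k<n. d k = d 0" using that by blast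
  define r where "r = d 0"
  have "d k = r" if "k < n" for k using const that unfolding r_def by blast
  then have "diagm n (\<lambda>i. of_real (d i)) = of_real r \<cdot>\<^sub>m 1\<^sub>m n"
    unfolding diagm_const[symmetric] by (intro eq_matI) (simp_all add: diagm_def)
  moreover have "U * (c \<cdot>\<^sub>m 1\<^sub>m n) * dag U = c \<cdot>\<^sub>m 1\<^sub>m n" for c
  proof -
    have Uc: "U \<in> carrier_mat n n" "U * dag U = 1\<^sub>m n" using U by (auto simp: unitary_def)
    have "U * (c \<cdot>\<^sub>m 1\<^sub>m n) = c \<cdot>\<^sub>m U" using mult_smult_distrib[OF Uc(1) one_carrier_mat, of c] Uc(1) by simp
    then show ?thesis using mult_smult_assoc_mat[OF Uc(1) dag_carrier[OF Uc(1)], of c] Uc(2) by simp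
  qed
  ultimately show False using ns A by metis
qed

text \<open>Passes a bound that holds for every recovery, or every coefficient matrix, to the
  infimum. The factor 0 is separate because the argument divides by \<open>s\<close>.\<close>

lemma le_mult_cInf:
  fixes s :: real
  assumes "X \<noteq> {}" "s \<ge> 0" "\<And>x. x \<in> X \<Longrightarrow> x \<ge> 0" "\<And>x. x \<in> X \<Longrightarrow> c \<le> s * x"
  shows "c \<le> s * Inf X"
proof (cases "s = 0")
  case True
  then show ?thesis using assms by auto
next
  case False
  then have s: "s > 0" using assms(2) by simp
  have "c / s \<le> Inf X"
    using assms(1,4) s by (intro cInf_greatest) (auto simp: pos_divide_le_eq mult.commute)
  then show ?thesis using s by (simp add: pos_divide_le_eq mult.commute)
qed

lemma mv_scale: "mv A (\<lambda>i. c * x i) = (\<lambda>i. c * mv A x i)"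
  by (rule ext) (simp add: mv_def sum_distrib_left mult_ac)

lemma mv_conj_diagm_eigenvector:
  assumes "unitary n U" "k < n"
  defines "v \<equiv> mv U (\<lambda>i. if i = k then 1 else 0)"
  shows "mv (U * diagm n d * dag U) v = (\<lambda>i. d k * v i)"
proof -
  let ?e = "\<lambda>i. if i = k then 1 else 0 :: complex"
  have U: "U \<in> carrier_mat n n" "dag U * U = 1\<^sub>m n" using assms by (auto simp: unitary_def)
  have "mv (U * diagm n d * dag U) v = mv U (mv (diagm n d) (mv (dag U * U) ?e))"
    using U(1) by (simp add: mv_mult v_def)
  also have "\<dots> = mv U (\<lambda>i. d k * ?e i)"
    using U by (intro mv_cong) (auto simp: mv_diagm mv_one)
  finally show ?thesis by (simp only: mv_scale v_def)
qed

lemma charge_fluctuation_le_inaccuracy: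
  fixes w :: "nat \<Rightarrow> nat \<Rightarrow> complex"
  assumes dL: "dL \<ge> 2" and V: "V \<in> carrier_mat dS dL" "dag V * V = 1\<^sub>m dL"
    and Ks: "kraus_channel dS dS Ks"
    and HS: "hermitian dS HS" "HS = kraus_comb dS Ks c"
    and w: "\<And>b. b < 2 \<Longrightarrow> nsq dL (w b) = 1"
    and \<mu>: "\<And>b. \<mu> b = Re (ip dS (mv V (w b)) (mv HS (mv V (w b))))"
  shows "\<mu> 0 - \<mu> 1 \<le> 2 * qec_inacc dL dS V Ks * frakJ dS Ks HS"
proof -
  define X where "X = {chan_pdist dL dL (comp_kraus R (comp_kraus Ks [V])) [1\<^sub>m dL] | R. kraus_channel dS dL R}"
  define Y where "Y = {spread h | h. hermitian (length Ks) h \<and> HS = kraus_comb dS Ks (\<lambda>i j. h $$ (i,j))}"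
  have K: "\<And>K. K \<in> set Ks \<Longrightarrow> K \<in> carrier_mat dS dS" using Ks by (auto simp: kraus_channel_def)
  have Xne: "X \<noteq> {}" using kraus_channel_exists[of dL dS] dL by (auto simp: X_def)
  have Yne: "Y \<noteq> {}" using hermitian_kraus_coefficients[OF HS K] by (auto simp: Y_def)
  have key: "0 \<le> e \<and> 0 \<le> s \<and> \<mu> 0 - \<mu> 1 \<le> 2 * s * e" if eX: "e \<in> X" and sY: "s \<in> Y" for e s
  proof -
    obtain R where R: "kraus_channel dS dL R" and e: "e = chan_pdist dL dL (comp_kraus R (comp_kraus Ks [V])) [1\<^sub>m dL]"
      using eX by (auto simp: X_def)
    obtain h where h: "hermitian (length Ks) h" "HS = kraus_comb dS Ks (\<lambda>i j. h $$ (i,j))" and s: "s = spread h"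
      using sY by (auto simp: Y_def)
    define F where "F = (\<Sum>K\<leftarrow>comp_kraus R (comp_kraus Ks [V]). (cmod ((\<Sum>b<2. ip dL (w b) (mv K (w b))) / 2))\<^sup>2)"
    note bound = charge_fluctuation_bound[OF V Ks R w h F_def \<mu>]
    have Kc: "\<forall>K\<in>set (comp_kraus R (comp_kraus Ks [V])). K \<in> carrier_mat dL dL"
    proof
      fix M assume "M \<in> set (comp_kraus R (comp_kraus Ks [V]))"
      then obtain A B where "A \<in> set R" "B \<in> set Ks" "M = A * (B * V)" by (auto simp: comp_kraus_def)
      then show "M \<in> carrier_mat dL dL"
        using R K V(1) by (auto simp: kraus_channel_def intro!: mult_carrier_mat)
    qed
    have "ip dL (mv (1\<^sub>m dL) (w b)) y = ip dL (w b) y" for b y by (intro ip_cong) (auto simp: mv_one)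
    then have "sqrt (1 - F) \<le> e"
      using chan_pdist_ge[OF dL w Kc one_carrier_mat] by (simp add: F_def e)
    moreover have "0 \<le> sqrt (1 - F)" using bound(1) by simp
    \<comment> \<open>An empty Kraus list would send the unit vector \<open>mv V (w 0)\<close> to
      norm 0, against completeness.\<close>
    moreover have n: "length Ks > 0"
    proof (rule ccontr)
      assume "\<not> length Ks > 0"
      then have "nsq dS (mv V (w 0)) = 0" using kraus_channel_ip[OF Ks, of "mv V (w 0)" "mv V (w 0)"] by (simp add: ip_self)
      moreover have "complex_of_real (nsq dS (mv V (w 0))) = of_real (nsq dL (w 0))"
        using isometry_ip[OF V, of "w 0" "w 0"] by (simp only: ip_self)
      ultimately show False using w[of 0] by simp
    qed
    then have "s \<ge> 0" using spread_nonneg[OF h(1)] s by simp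
    moreover have "\<mu> 0 - \<mu> 1 \<le> 2 * s * sqrt (1 - F)" using bound(2) s by simp
    ultimately show ?thesis by (smt (verit) mult_left_mono)
  qed
  \<comment> \<open>The infima are taken one after the other: over recoveries with the spread fixed,
    then over spreads with the nonnegative factor \<open>2 * Inf X\<close>.\<close>
  have "\<mu> 0 - \<mu> 1 \<le> (2 * s) * Inf X" if "s \<in> Y" for s
    using Xne key[OF _ that] by (intro le_mult_cInf) auto
  moreover have "Inf X \<ge> 0" using Xne Yne key by (intro cInf_greatest) auto
  ultimately have "\<mu> 0 - \<mu> 1 \<le> (2 * Inf X) * Inf Y"
    using Yne Xne key by (intro le_mult_cInf) (auto simp: mult_ac)
  then show ?thesis by (simp add: qec_inacc_def frakJ_def X_def Y_def)
qed

lemma cov_viol_lower_bound: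
  assumes V: "V \<in> carrier_mat dS dL" "dag V * V = 1\<^sub>m dL" and Ks: "kraus_channel dS dS Ks"
    and HL: "hermitian dL HL" "\<nexists>c. HL = c \<cdot>\<^sub>m 1\<^sub>m dL"
    and HS: "hermitian dS HS" "\<nexists>c. HS = c \<cdot>\<^sub>m 1\<^sub>m dS" "HS = kraus_comb dS Ks c"
    and y: "y = sqrt ((spread HL - 2 * qec_inacc dL dS V Ks * frakJ dS Ks HS) / spread HS)"
  shows "y - y\<^sup>2 \<le> cov_viol dL dS V HL HS"
proof -
  obtain UL and dl :: "nat \<Rightarrow> real" where UL: "unitary dL UL" and HLd: "HL = UL * diagm dL (\<lambda>i. of_real (dl i)) * dag UL"
    using hermitian_spectral[OF HL(1)] by blast
  obtain US and E :: "nat \<Rightarrow> real" where US: "unitary dS US" and HSd: "HS = US * diagm dS (\<lambda>i. of_real (E i)) * dag US"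
    using hermitian_spectral[OF HS(1)] by blast
  have ULc: "UL \<in> carrier_mat dL dL" "dag UL * UL = 1\<^sub>m dL" and USc: "US \<in> carrier_mat dS dS"
    using UL US by (auto simp: unitary_def)
  obtain kL where kL: "kL < dL" "dl kL \<noteq> dl 0" using nonscalar_eigenvalues_differ[OF UL HLd HL(2)] .
  obtain kS where kS: "kS < dS" "E kS \<noteq> E 0" using nonscalar_eigenvalues_differ[OF US HSd HS(2)] .
  \<comment> \<open>Two distinct eigenvalues need two dimensions; the reference, of the same
    dimension, then has the two labels used by \<open>ent\<close>.\<close>
  have dL: "dL \<ge> 2" using kL by (cases "kL = 0") auto
  define Emax Emin where "Emax = Max (E ` {..<dS})" and "Emin = Min (E ` {..<dS})"
  have E: "Emin \<le> E k \<and> E k \<le> Emax" if "k < dS" for k using that by (auto simp: Emax_def Emin_def)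
  have ES: "Emin < Emax" using E[OF kS(1)] E[of 0] kS by fastforce
  have spS: "spread HS = Emax - Emin" unfolding HSd Emax_def Emin_def by (rule spread_conj_diagm[OF US])
  have "Max (dl ` {..<dL}) \<in> dl ` {..<dL}" "Min (dl ` {..<dL}) \<in> dl ` {..<dL}"
    using dL by (auto intro!: Max_in Min_in simp: lessThan_empty_iff)
  then obtain kmax kmin where k: "kmax < dL" "Max (dl ` {..<dL}) = dl kmax" "kmin < dL" "Min (dl ` {..<dL}) = dl kmin"
    by auto
  define kk where "kk b = (if b = 0 then kmax else kmin)" for b :: nat
  have kk: "kk b < dL" for b using k by (simp add: kk_def)
  define l where "l b = dl (kk b)" for b
  have spL: "spread HL = l 0 - l 1" unfolding HLd spread_conj_diagm[OF UL] using k by (simp add: l_def kk_def)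
  define w where "w b = mv UL (\<lambda>i. if i = kk b then 1 else 0)" for b
  have w: "nsq dL (w b) = 1" for b
  proof -
    have "complex_of_real (nsq dL (w b)) = ip dL (\<lambda>i. if i = kk b then 1 else 0) (\<lambda>i. if i = kk b then 1 else 0)"
      unfolding w_def ip_self[symmetric] by (rule isometry_ip[OF ULc])
    also have "\<dots> = of_real 1" unfolding ip_def using kk[of b] by (subst sum_lessThan_single[of "kk b"]) auto
    finally show ?thesis by (simp only: of_real_eq_iff)
  qed
  define v where "v b = mv V (w b)" for b
  have v: "nsq dS (v b) = 1" for b
  proof -
    have "complex_of_real (nsq dS (v b)) = of_real (nsq dL (w b))"
      unfolding v_def ip_self[symmetric] by (rule isometry_ip[OF V])
    then show ?thesis using w by simp
  qed
  define p where "p b k = (cmod (mv (dag US) (v b) k))\<^sup>2" for b k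
  have p1: "(\<Sum>k<dS. p b k) = 1" for b
  proof -
    have "complex_of_real (nsq dS (mv (dag US) (v b))) = of_real (nsq dS (v b))"
      unfolding ip_self[symmetric] by (rule ip_unitary[OF US])
    then have "nsq dS (mv (dag US) (v b)) = 1" unfolding of_real_eq_iff v .
    then show ?thesis unfolding nsq_def p_def .
  qed
  have p0: "p b k \<ge> 0" for b k by (simp add: p_def)
  have quad: "ip dS (v b) (mv (US * diagm dS g * dag US) (v b)) = (\<Sum>k<dS. of_real (p b k) * g k)" for b g
    unfolding ip_conj_diagm[OF USc] p_def complex_norm_square by (simp only: mult_ac)
  define \<mu> where "\<mu> b = Re (ip dS (mv V (w b)) (mv HS (mv V (w b))))" for b
  have \<mu>p: "\<mu> b = (\<Sum>k<dS. p b k * E k)" for b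
    unfolding \<mu>_def HSd v_def[symmetric] quad by simp
  have fluct: "\<mu> 0 - \<mu> 1 \<le> 2 * qec_inacc dL dS V Ks * frakJ dS Ks HS"
    by (rule charge_fluctuation_le_inaccuracy[OF dL V Ks HS(1,3) w \<mu>_def])
  let ?\<delta> = "cov_viol dL dS V HL HS"
  \<comment> \<open>The overlap of the two covariance outputs on the probe: the logical evolution
    acts on \<open>w b\<close> as a phase, whose conjugate shifts the energies by
    \<open>l b\<close>.\<close>
  define \<phi> where "\<phi> \<theta> = (\<Sum>b<2. \<Sum>k<dS. of_real (p b k) * exp (- \<i> * of_real \<theta> * of_real (E k - l b))) / 2" for \<theta> :: real
  have amp: "sqrt (1 - (cmod (\<phi> \<theta>))\<^sup>2) \<le> ?\<delta>" for \<theta>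
  proof -
    let ?A = "U1 HS \<theta> * V" and ?B = "V * U1 HL \<theta>"
    have US1: "U1 HS \<theta> = US * diagm dS (\<lambda>i. exp (- \<i> * of_real \<theta> * of_real (E i))) * dag US"
      unfolding HSd by (rule U1_conj_diagm[OF US])
    have UL1: "U1 HL \<theta> = UL * diagm dL (\<lambda>i. exp (- \<i> * of_real \<theta> * of_real (dl i))) * dag UL"
      unfolding HLd by (rule U1_conj_diagm[OF UL])
    have c1: "U1 HS \<theta> \<in> carrier_mat dS dS" "U1 HL \<theta> \<in> carrier_mat dL dL"
      unfolding US1 UL1 using USc ULc by auto
    then have c2: "?A \<in> carrier_mat dS dL" "?B \<in> carrier_mat dS dL"
      using V(1) by (auto intro: mult_carrier_mat)
    have overlap: "ip dS (mv ?B (w b)) (mv ?A (w b)) = 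
       (\<Sum>k<dS. of_real (p b k) * exp (- \<i> * of_real \<theta> * of_real (E k - l b)))" for b
    proof -
      let ?e = "exp (- \<i> * of_real \<theta> * of_real (l b))"
      have B: "mv ?B (w b) = (\<lambda>i. ?e * v b i)"
      proof -
        have "mv ?B (w b) = mv V (mv (U1 HL \<theta>) (w b))" using V(1) c1 by (intro mv_mult) auto
        also have "mv (U1 HL \<theta>) (w b) = (\<lambda>i. ?e * w b i)"
          unfolding UL1 w_def l_def by (rule mv_conj_diagm_eigenvector[OF UL kk])
        finally show ?thesis by (simp only: mv_scale v_def)
      qed
      have A: "mv ?A (w b) = mv (U1 HS \<theta>) (v b)" using V(1) c1 unfolding v_def by (intro mv_mult) auto
      have "ip dS (mv ?B (w b)) (mv ?A (w b)) = cnj ?e * ip dS (v b) (mv (U1 HS \<theta>) (v b))"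
        unfolding A B by (simp add: ip_def sum_distrib_left mult_ac)
      also have "\<dots> = (\<Sum>k<dS. of_real (p b k) * (cnj ?e * exp (- \<i> * of_real \<theta> * of_real (E k))))"
        unfolding US1 quad by (simp add: sum_distrib_left mult_ac)
      also have "\<dots> = (\<Sum>k<dS. of_real (p b k) * exp (- \<i> * of_real \<theta> * of_real (E k - l b)))"
        by (intro sum.cong refl arg_cong2[where f = "(*)"]) (simp add: exp_cnj mult_exp_exp algebra_simps)
      finally show ?thesis .
    qed
    have "sqrt (1 - (cmod (\<phi> \<theta>))\<^sup>2) \<le> chan_pdist dL dS [?A] [?B]"
      using chan_pdist_ge[where Ks = "[?A]" and w = w, OF dL w _ c2(2)] c2(1) by (simp add: \<phi>_def overlap)
    also have "\<dots> \<le> ?\<delta>"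
      unfolding cov_viol_def
      by (rule cSup_upper) (use dL chan_pdist_le_1[of dL] in \<open>auto intro!: bdd_aboveI[of _ 1]\<close>)
    finally show ?thesis .
  qed
  \<comment> \<open>Keeps the argument of \<open>sqrt\<close> in \<open>amp\<close> nonnegative, so
    that \<open>amp\<close> may be squared and \<open>cov_viol\<close> is nonnegative.\<close>
  have \<phi>1: "cmod (\<phi> \<theta>) \<le> 1" for \<theta>
  proof -
    have "cmod (\<Sum>b<2. \<Sum>k<dS. of_real (p b k) * exp (- \<i> * of_real \<theta> * of_real (E k - l b))) \<le> 
      (\<Sum>b<2. \<Sum>k<dS. cmod (of_real (p b k) * exp (- \<i> * of_real \<theta> * of_real (E k - l b))))"
      by (intro order.trans[OF norm_sum] sum_mono norm_sum)
    also have "\<dots> = (\<Sum>b<2::nat. \<Sum>k<dS. p b k)" using p0 by (simp add: norm_mult)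
    finally show ?thesis by (simp add: \<phi>_def p1 norm_divide)
  qed
  have \<phi>2: "(cmod (\<phi> \<theta>))\<^sup>2 \<le> 1" for \<theta> using \<phi>1[of \<theta>] by (simp add: power_le_one)
  have \<delta>0: "?\<delta> \<ge> 0" using order.trans[OF _ amp[of 0]] \<phi>2[of 0] by simp
  have fid: "1 - ?\<delta>\<^sup>2 \<le> (cmod (\<phi> \<theta>))\<^sup>2" for \<theta>
  proof -
    have "(sqrt (1 - (cmod (\<phi> \<theta>))\<^sup>2))\<^sup>2 \<le> ?\<delta>\<^sup>2" using amp[of \<theta>] \<phi>2[of \<theta>] by (intro power_mono) auto
    then show ?thesis using \<phi>2[of \<theta>] by simp
  qed
  have mean: "(\<Sum>k<dS. p b k * (E k - l b)) = \<mu> b - l b" for b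
    by (simp add: \<mu>p right_diff_distrib sum_subtractf sum_distrib_right[symmetric] p1)
  show ?thesis
  proof (rule mean_shift_bound[where p = p and E = E and l = l and n = dS and Emin = Emin and Emax = Emax 
        and D = "spread HL - 2 * qec_inacc dL dS V Ks * frakJ dS Ks HS"])
    show "1 - ?\<delta>\<^sup>2 \<le> (cmod ((\<Sum>b<2. \<Sum>k<dS. of_real (p b k) * exp (- \<i> * of_real \<theta> * of_real (E k - l b))) / 2))\<^sup>2" for \<theta>
      using fid[of \<theta>] unfolding \<phi>_def .
    \<comment> \<open>The difference of shifted means is
      \<open>(l 0 - l 1) - (\<mu> 0 - \<mu> 1)\<close>, which is why the upper bound on
      \<open>\<mu> 0 - \<mu> 1\<close> is the one used.\<close>
    show "spread HL - 2 * qec_inacc dL dS V Ks * frakJ dS Ks HS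
      \<le> (\<Sum>k<dS. p 1 k * (E k - l 1)) - (\<Sum>k<dS. p 0 k * (E k - l 0))"
      unfolding mean spL using fluct by linarith
    show "y = sqrt ((spread HL - 2 * qec_inacc dL dS V Ks * frakJ dS Ks HS) / (Emax - Emin))"
      unfolding y spS ..
  qed (use p0 p1 E ES \<delta>0 in auto)
qed

theorem theorem1:
  "\<exists>ell :: real \<Rightarrow> real. (\<lambda>y. ell y - y) \<in> O[at 0](\<lambda>y. y\<^sup>2) \<and>
    (\<forall>dL dS (Ks :: complex mat list) V HL HS.
       V \<in> carrier_mat dS dL \<and> dag V * V = 1\<^sub>m dL \<and>
       kraus_channel dS dS Ks \<and>
       hermitian dL HL \<and> (\<nexists>c. HL = c \<cdot>\<^sub>m 1\<^sub>m dL) \<and>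
       hermitian dS HS \<and> (\<nexists>c. HS = c \<cdot>\<^sub>m 1\<^sub>m dS) \<and>
       (\<exists>c. HS = kraus_comb dS Ks c)
     \<longrightarrow> cov_viol dL dS V HL HS \<ge>
         ell (sqrt ((spread HL - 2 * qec_inacc dL dS V Ks * frakJ dS Ks HS) / spread HS)))"
\<comment> \<open>One function serves all systems and dimensions; its deviation from
  \<open>y\<close> is exactly the quadratic term.\<close>
proof (intro exI[of _ "\<lambda>y. y - y\<^sup>2"] conjI allI impI)
  show "(\<lambda>y::real. (y - y\<^sup>2) - y) \<in> O[at 0](\<lambda>y. y\<^sup>2)" by simp
qed (elim conjE exE, rule cov_viol_lower_bound, auto)

end
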